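(* Let $(X,\|\cdot\|_X)$ be a reflexive real Banach space, let $\Psi\in\Gamma_G(X)$ be Fr\'echet differentiable on $\mathrm{int\,dom}\,\Psi$, and let $\varnothing\ne K\subseteq\mathrm{int\,dom}\,\Psi$. Then: (i) if $K$ is convex and closed, and $\Psi$ is totally convex on $\mathrm{dom}\,\Psi$ and supercoercive, then the left projection $\overleftarrow{P}_K$ is norm-to-norm continuous on $\mathrm{int\,dom}\,\Psi$, and $x\mapsto\inf_{y\in K}D_\Psi(y,x)$ is continuous on $\mathrm{int\,dom}\,\Psi$; (ii) if $K$ is convex and closed, and $\Psi$ is totally convex on bounded subsets of $X$, supercoercive, and Euler--Legendre, then $\overleftarrow{P}_K$ is norm-to-norm continuous on $\mathrm{int\,dom}\,\Psi$; (iii) if $D\Psi(K)$ is convex and closed, $\varnothing\ne D\Psi(\mathrm{int\,dom}\,\Psi)\subseteq\mathrm{int\,dom}\,\Psi^*$, and $\Psi^*$ is totally convex on $\mathrm{dom}\,\Psi^*$, Fr\'echet differentiable on $\mathrm{int\,dom}\,\Psi^*$, and supercoercive, then the right projection $\overrightarrow{P}_K$ is norm-to-norm continuous on $\mathrm{int\,dom}\,\Psi$; (iv) if $D\Psi(K)$ is convex and closed, and $\Psi^*$ is totally convex on bounded subsets of $X^*$, Euler--Legendre, Fr\'echet differentiable on $\mathrm{int\,dom}\,\Psi^*$, and supercoercive, then $\overrightarrow{P}_K$ is norm-to-norm continuous on $\mathrm{int\,dom}\,\Psi$.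
   Context: $\langle\cdot,\cdot\rangle$ is the pairing of $X\times X^*$; $X^{**}=X$ by reflexivity. For $\Psi:X\to\,]-\infty,\infty]$, $\mathrm{dom}\,\Psi=\{x:\Psi(x)\neq\infty\}$ and $\mathrm{int\,dom}\,\Psi$ is its norm interior. $\Gamma_G(X)$ is the set of proper convex lower semicontinuous $\Psi:X\to\,]-\infty,\infty]$ with $\mathrm{int\,dom}\,\Psi\neq\varnothing$ that are Gateaux differentiable on $\mathrm{int\,dom}\,\Psi$, with derivative $D\Psi$. $\Psi^*$ is the convex conjugate on $X^*$. $D_\Psi(x,y)=\Psi(x)-\Psi(y)-\langle x-y,D\Psi(y)\rangle$ for $x\in X$, $y\in\mathrm{int\,dom}\,\Psi$. For $y\in\mathrm{int\,dom}\,\Psi$, the left projection $\overleftarrow{P}_K(y)$ is the unique minimiser of $x\mapsto D_\Psi(x,y)$ over $x\in K$, and the right projection $\overrightarrow{P}_K(y)$ is the unique minimiser of $x\mapsto D_\Psi(y,x)$ over $x\in K$ (under the respective hypotheses these exist uniquely). With $D_+\Psi(x;h)=\lim_{t\to0^+}(\Psi(x+th)-\Psi(x))/t$ and $\nu_\Psi(x,t)=\inf\{\Psi(y)-\Psi(x)-D_+\Psi(x;y-x): y\in\mathrm{dom}\,\Psi,\|y-x\|=t\}$: $\Psi$ is totally convex on $\mathrm{dom}\,\Psi$ iff $\nu_\Psi(x,t)>0$ for all $t>0$ and $x\in\mathrm{dom}\,\Psi$; totally convex on bounded subsets iff $\inf\{\nu_\Psi(x,t):x\in Y\cap\mathrm{dom}\,\Psi\}>0$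 for all $t>0$ and all bounded $\varnothing\ne Y\subseteq X$. Supercoercive: $\lim_{\|x\|\to\infty}\Psi(x)/\|x\|=\infty$. Essentially Gateaux differentiable: $\mathrm{int\,dom}\,\Psi\neq\varnothing$ and $\partial\Psi(x)$ is a singleton whenever nonempty. Essentially strictly convex: $\Psi$ is strictly convex on every convex subset of $\{x:\partial\Psi(x)\ne\varnothing\}$ and $(\partial\Psi)^{-1}$ is locally bounded on its domain. Euler--Legendre: both. The same definitions apply to $\Psi^*$ on $X^*$. *)

theory Defs
  imports "HOL-Analysis.Analysis"
begin

text \<open>
  The dual of a normed space is rendered as the type of bounded linear functionals
  \<open>'a \<Rightarrow>\<^sub>L real\<close> with the operator norm.  All notions below are stated on an arbitrary real
  normed space, so that they apply to a function on \<open>X\<close> and to its conjugate on \<open>X\<^sup>*\<close>.  For a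
  function on \<open>X\<^sup>*\<close>, subgradients and derivatives are then elements of the bidual.
\<close>

definition bidual_embedding :: "'a::real_normed_vector \<Rightarrow> ('a \<Rightarrow>\<^sub>L real) \<Rightarrow>\<^sub>L real" where
  "bidual_embedding x = Blinfun (\<lambda>\<phi>. blinfun_apply \<phi> x)"

definition reflexive :: "'a::real_normed_vector itself \<Rightarrow> bool" where
  "reflexive _ \<longleftrightarrow> surj (bidual_embedding :: 'a \<Rightarrow> ('a \<Rightarrow>\<^sub>L real) \<Rightarrow>\<^sub>L real)"

definition edom :: "('a \<Rightarrow> ereal) \<Rightarrow> 'a set" where
  "edom \<Psi> = {x. \<Psi> x \<noteq> \<infinity>}"

definition proper_fun :: "('a \<Rightarrow> ereal) \<Rightarrow> bool" where
  "proper_fun \<Psi> \<longleftrightarrow> (\<forall>x. \<Psi> x \<noteq> -\<infinity>) \<and> edom \<Psi> \<noteq> {}"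

definition convex_fun :: "('a::real_vector \<Rightarrow> ereal) \<Rightarrow> bool" where
  "convex_fun \<Psi> \<longleftrightarrow> (\<forall>x y u. 0 < u \<and> u < 1 \<longrightarrow>
     \<Psi> ((1 - u) *\<^sub>R x + u *\<^sub>R y) \<le> ereal (1 - u) * \<Psi> x + ereal u * \<Psi> y)"

definition strictly_convex_fun_on :: "'a::real_vector set \<Rightarrow> ('a \<Rightarrow> ereal) \<Rightarrow> bool" where
  "strictly_convex_fun_on S \<Psi> \<longleftrightarrow> (\<forall>x\<in>S. \<forall>y\<in>S. \<forall>u. x \<noteq> y \<and> 0 < u \<and> u < 1 \<longrightarrow>
     \<Psi> ((1 - u) *\<^sub>R x + u *\<^sub>R y) < ereal (1 - u) * \<Psi> x + ereal u * \<Psi> y)"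

definition lower_semicontinuous_fun :: "('a::topological_space \<Rightarrow> ereal) \<Rightarrow> bool" where
  "lower_semicontinuous_fun \<Psi> \<longleftrightarrow> (\<forall>x. \<Psi> x \<le> Liminf (nhds x) \<Psi>)"

definition conjugate :: "('a::real_normed_vector \<Rightarrow> ereal) \<Rightarrow> ('a \<Rightarrow>\<^sub>L real) \<Rightarrow> ereal" where
  "conjugate \<Psi> \<phi> = (SUP x. ereal (blinfun_apply \<phi> x) - \<Psi> x)"

text \<open>
  Derivatives are only ever taken at interior points of the domain of a proper function, where the
  function is finite nearby; hence the passage to real values loses nothing.
\<close>

definition has_gateaux_derivative ::
  "('a::real_normed_vector \<Rightarrow> ereal) \<Rightarrow> ('a \<Rightarrow>\<^sub>L real) \<Rightarrow> 'a \<Rightarrow> bool" where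
  "has_gateaux_derivative \<Psi> \<phi> x \<longleftrightarrow> (\<forall>h.
     ((\<lambda>t. (real_of_ereal (\<Psi> (x + t *\<^sub>R h)) - real_of_ereal (\<Psi> x)) / t)
        \<longlongrightarrow> blinfun_apply \<phi> h) (at 0))"

definition gateaux_differentiable_on_int_dom :: "('a::real_normed_vector \<Rightarrow> ereal) \<Rightarrow> bool" where
  "gateaux_differentiable_on_int_dom \<Psi> \<longleftrightarrow>
     (\<forall>x\<in>interior (edom \<Psi>). \<exists>\<phi>. has_gateaux_derivative \<Psi> \<phi> x)"

definition gateaux_derivative :: "('a::real_normed_vector \<Rightarrow> ereal) \<Rightarrow> 'a \<Rightarrow> 'a \<Rightarrow>\<^sub>L real" where
  "gateaux_derivative \<Psi> x = (THE \<phi>. has_gateaux_derivative \<Psi> \<phi> x)"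

definition frechet_differentiable_on_int_dom :: "('a::real_normed_vector \<Rightarrow> ereal) \<Rightarrow> bool" where
  "frechet_differentiable_on_int_dom \<Psi> \<longleftrightarrow>
     (\<forall>x\<in>interior (edom \<Psi>). (\<lambda>z. real_of_ereal (\<Psi> z)) differentiable (at x))"

definition Gamma_G :: "('a::real_normed_vector \<Rightarrow> ereal) set" where
  "Gamma_G = {\<Psi>. proper_fun \<Psi> \<and> convex_fun \<Psi> \<and> lower_semicontinuous_fun \<Psi> \<and>
     interior (edom \<Psi>) \<noteq> {} \<and> gateaux_differentiable_on_int_dom \<Psi>}"

definition bregman :: "('a::real_normed_vector \<Rightarrow> ereal) \<Rightarrow> 'a \<Rightarrow> 'a \<Rightarrow> ereal" where
  "bregman \<Psi> x y = \<Psi> x - \<Psi> y - ereal (blinfun_apply (gateaux_derivative \<Psi> y) (x - y))"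

definition is_left_projection ::
  "('a::real_normed_vector \<Rightarrow> ereal) \<Rightarrow> 'a set \<Rightarrow> 'a \<Rightarrow> 'a \<Rightarrow> bool" where
  "is_left_projection \<Psi> K y p \<longleftrightarrow> is_arg_min (\<lambda>x. bregman \<Psi> x y) (\<lambda>x. x \<in> K) p"

definition is_right_projection ::
  "('a::real_normed_vector \<Rightarrow> ereal) \<Rightarrow> 'a set \<Rightarrow> 'a \<Rightarrow> 'a \<Rightarrow> bool" where
  "is_right_projection \<Psi> K y p \<longleftrightarrow> is_arg_min (\<lambda>x. bregman \<Psi> y x) (\<lambda>x. x \<in> K) p"

definition left_projection :: "('a::real_normed_vector \<Rightarrow> ereal) \<Rightarrow> 'a set \<Rightarrow> 'a \<Rightarrow> 'a" where
  "left_projection \<Psi> K y = (THE p. is_left_projection \<Psi> K y p)"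

definition right_projection :: "('a::real_normed_vector \<Rightarrow> ereal) \<Rightarrow> 'a set \<Rightarrow> 'a \<Rightarrow> 'a" where
  "right_projection \<Psi> K y = (THE p. is_right_projection \<Psi> K y p)"

text \<open>
  Norm-to-norm continuity of the projections on \<open>int dom \<Psi>\<close>.  Well-definedness (existence of a
  unique minimiser) is part of the assertion, so that it never concerns an arbitrary value of
  the description operator.
\<close>

definition left_projection_continuous ::
  "('a::real_normed_vector \<Rightarrow> ereal) \<Rightarrow> 'a set \<Rightarrow> bool" where
  "left_projection_continuous \<Psi> K \<longleftrightarrow>
     (\<forall>y\<in>interior (edom \<Psi>). \<exists>!p. is_left_projection \<Psi> K y p) \<and>
     continuous_on (interior (edom \<Psi>)) (left_projection \<Psi> K)"

definition right_projection_continuous ::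
  "('a::real_normed_vector \<Rightarrow> ereal) \<Rightarrow> 'a set \<Rightarrow> bool" where
  "right_projection_continuous \<Psi> K \<longleftrightarrow>
     (\<forall>y\<in>interior (edom \<Psi>). \<exists>!p. is_right_projection \<Psi> K y p) \<and>
     continuous_on (interior (edom \<Psi>)) (right_projection \<Psi> K)"

text \<open>
  For convex \<open>\<Psi>\<close> and \<open>x\<close> in its domain the limit below exists in the extended reals; it may be
  infinite, so it is taken there.
\<close>

definition right_dir_derivative ::
  "('a::real_normed_vector \<Rightarrow> ereal) \<Rightarrow> 'a \<Rightarrow> 'a \<Rightarrow> ereal" where
  "right_dir_derivative \<Psi> x h = Lim (at_right 0) (\<lambda>t. (\<Psi> (x + t *\<^sub>R h) - \<Psi> x) / ereal t)"

text \<open>The infimum of the empty set is \<open>\<infinity>\<close>.\<close>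

definition total_convexity_modulus ::
  "('a::real_normed_vector \<Rightarrow> ereal) \<Rightarrow> 'a \<Rightarrow> real \<Rightarrow> ereal" where
  "total_convexity_modulus \<Psi> x t =
     Inf {\<Psi> y - \<Psi> x - right_dir_derivative \<Psi> x (y - x) | y. y \<in> edom \<Psi> \<and> norm (y - x) = t}"

definition totally_convex_on_dom :: "('a::real_normed_vector \<Rightarrow> ereal) \<Rightarrow> bool" where
  "totally_convex_on_dom \<Psi> \<longleftrightarrow> (\<forall>t>0. \<forall>x\<in>edom \<Psi>. total_convexity_modulus \<Psi> x t > 0)"

definition totally_convex_on_bounded :: "('a::real_normed_vector \<Rightarrow> ereal) \<Rightarrow> bool" where
  "totally_convex_on_bounded \<Psi> \<longleftrightarrow> (\<forall>t>0. \<forall>Y. Y \<noteq> {} \<and> bounded Y \<longrightarrow>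
     (INF x\<in>Y \<inter> edom \<Psi>. total_convexity_modulus \<Psi> x t) > 0)"

definition supercoercive :: "('a::real_normed_vector \<Rightarrow> ereal) \<Rightarrow> bool" where
  "supercoercive \<Psi> \<longleftrightarrow> ((\<lambda>x. \<Psi> x / ereal (norm x)) \<longlongrightarrow> \<infinity>) at_infinity"

definition subdifferential ::
  "('a::real_normed_vector \<Rightarrow> ereal) \<Rightarrow> 'a \<Rightarrow> ('a \<Rightarrow>\<^sub>L real) set" where
  "subdifferential \<Psi> x =
     {\<phi>. x \<in> edom \<Psi> \<and> (\<forall>y. \<Psi> x + ereal (blinfun_apply \<phi> (y - x)) \<le> \<Psi> y)}"

definition essentially_gateaux_differentiable ::
  "('a::real_normed_vector \<Rightarrow> ereal) \<Rightarrow> bool" where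
  "essentially_gateaux_differentiable \<Psi> \<longleftrightarrow> interior (edom \<Psi>) \<noteq> {} \<and>
     (\<forall>x. subdifferential \<Psi> x \<noteq> {} \<longrightarrow> is_singleton (subdifferential \<Psi> x))"

text \<open>
  A set-valued map is locally bounded at a point if some neighbourhood of that point has bounded
  image; here this is applied to the inverse of the subdifferential, at each point of its domain.
\<close>

definition essentially_strictly_convex :: "('a::real_normed_vector \<Rightarrow> ereal) \<Rightarrow> bool" where
  "essentially_strictly_convex \<Psi> \<longleftrightarrow>
     (\<forall>C. convex C \<and> C \<subseteq> {x. subdifferential \<Psi> x \<noteq> {}} \<longrightarrow> strictly_convex_fun_on C \<Psi>) \<and>
     (\<forall>\<phi>\<in>(\<Union>x. subdifferential \<Psi> x).
        \<exists>U. open U \<and> \<phi> \<in> U \<and> bounded {x. subdifferential \<Psi> x \<inter> U \<noteq> {}})"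

definition euler_legendre :: "('a::real_normed_vector \<Rightarrow> ereal) \<Rightarrow> bool" where
  "euler_legendre \<Psi> \<longleftrightarrow>
     essentially_gateaux_differentiable \<Psi> \<and> essentially_strictly_convex \<Psi>"

end

theory Submission
  imports Defs
begin

text \<open>
  Let \<open>p\<close> and \<open>q\<close> be the left projections of \<open>y\<close> and \<open>z\<close>.  The three-point inequality at \<open>p\<close>
  and the minimality of \<open>q\<close> give
  \<open>D\<^sub>\<Psi>(q, p) \<le> \<langle>q - p, D\<Psi>(z) - D\<Psi>(y)\<rangle> \<le> \<parallel>D\<Psi>(z) - D\<Psi>(y)\<parallel> \<parallel>q - p\<parallel>\<close>.
  Total convexity at \<open>p\<close> bounds the left-hand side below by \<open>c \<parallel>q - p\<parallel>\<close> with \<open>c > 0\<close> as soon as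
  \<open>\<parallel>q - p\<parallel> \<ge> \<epsilon>\<close>, and the derivative of a Frechet differentiable convex function is
  norm-to-norm continuous, so \<open>q \<rightarrow> p\<close> as \<open>z \<rightarrow> y\<close>.  Minimisers exist because the sublevel sets
  form a decreasing sequence of bounded closed convex sets, which in a reflexive space have a common
  point by the Hahn--Banach theorem in the dual.  Right projections are left projections for \<open>\<Psi>\<^sup>*\<close>:
  \<open>D\<^sub>\<Psi>(y, x) = D\<^sub>\<Psi>\<^sub>*(D\<Psi>(x), D\<Psi>(y))\<close>, and \<open>D\<Psi>\<^sup>*\<close> inverts \<open>D\<Psi>\<close> up to the embedding
  into the bidual.  In (iv) essential Gateaux differentiability of \<open>\<Psi>\<^sup>*\<close> forces
  \<open>D\<Psi>\<close> to take values in the interior of its domain.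
\<close>

section \<open>The Hahn--Banach theorem\<close>

text \<open>Homogeneity is asked only as an inequality for positive factors, which is easy to check
  for infima. Scaling back by \<open>inverse c\<close> gives equality, and \<open>c = 1/2\<close> at
  the origin forces \<open>p 0 = 0\<close>.\<close>

definition sublinear :: "('a::real_vector \<Rightarrow> real) \<Rightarrow> bool" where
  "sublinear p \<longleftrightarrow> (\<forall>x y. p (x + y) \<le> p x + p y) \<and> (\<forall>c x. 0 < c \<longrightarrow> p (c *\<^sub>R x) \<le> c * p x)"

lemma sublinear_add: "sublinear p \<Longrightarrow> p (x + y) \<le> p x + p y"
  by (simp add: sublinear_def)

lemma sublinear_scale:
  assumes "sublinear p" "0 \<le> c"
  shows "p (c *\<^sub>R x) = c * p x"
proof -
  have le: "p (c *\<^sub>R x) \<le> c * p x" if "0 < c" for c x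
    using assms(1) that by (simp add: sublinear_def)
  have "p 0 = 0"
    using le[of "1/2" 0] sublinear_add[OF assms(1), of 0 0] by simp
  moreover have "c * p x \<le> p (c *\<^sub>R x)" if "0 < c"
    using le[of "inverse c" "c *\<^sub>R x"] that by (simp add: field_simps)
  ultimately show ?thesis
    using le[of c x] assms(2) by (cases "c = 0") auto
qed

lemma sublinear_0: "sublinear p \<Longrightarrow> p 0 = 0"
  using sublinear_scale[of p 0 0] by simp

lemma sublinear_minus:
  assumes "sublinear p"
  shows "- p (- x) \<le> p x"
  using sublinear_add[OF assms, of x "- x"] sublinear_0[OF assms] by simp

lemma sublinear_norm: "sublinear norm"
  by (simp add: sublinear_def norm_triangle_ineq)

text \<open>The functional \<open>q\<close> is the largest sublinear one below \<open>p\<close> with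
  the required bound on \<open>- c\<close>. A linear functional below \<open>q\<close> is at least
  \<open>d\<close> on \<open>C\<close>, so domination and separation come together.\<close>

lemma sublinear_shrink:
  assumes p: "sublinear p" and C: "convex C" "C \<noteq> {}" and d: "\<And>c. c \<in> C \<Longrightarrow> d \<le> p c"
  obtains q where "sublinear q" "\<And>x. q x \<le> p x" "\<And>c. c \<in> C \<Longrightarrow> q (- c) \<le> - d"
proof
  define g where "g v = (\<lambda>(t, c). p (v + t *\<^sub>R c) - t * d)" for v
  define I where "I = {0::real..} \<times> C"
  define q where "q v = (INF i\<in>I. g v i)" for v
  have I: "I \<noteq> {}"
    using C by (auto simp: I_def)
  \<comment> \<open>The hypothesis \<open>d \<le> p c\<close> is exactly what keeps the infimum
    finite.\<close>
  have "- p (- v) \<le> g v i" if "i \<in> I" for v i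
  proof -
    from that obtain t c where i: "i = (t, c)" "0 \<le> t" "c \<in> C"
      by (auto simp: I_def)
    have "t * d \<le> t * p c"
      using i d by (simp add: mult_left_mono)
    also have "\<dots> = p ((v + t *\<^sub>R c) + (- v))"
      using i p by (simp add: sublinear_scale)
    also have "\<dots> \<le> p (v + t *\<^sub>R c) + p (- v)"
      by (rule sublinear_add[OF p])
    finally show ?thesis
      by (simp add: g_def i)
  qed
  then have bdd: "bdd_below (g v ` I)" for v
    by (intro bdd_belowI2[where m = "- p (- v)"])
  have le: "q v \<le> p (v + t *\<^sub>R c) - t * d" if "0 \<le> t" "c \<in> C" for v t c
    using cINF_lower[OF bdd, of "(t, c)" v] that by (simp add: q_def g_def I_def)
  show "q x \<le> p x" for x
    using le[of 0] C by force
  show "q (- c) \<le> - d" if "c \<in> C" for c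
    using le[of 1 c "- c"] that sublinear_0[OF p] by simp
  have "q (x + y) \<le> g x i + g y j" if ij: "i \<in> I" "j \<in> I" for x y i j
  proof -
    obtain t c s b where i: "i = (t, c)" "0 \<le> t" "c \<in> C" and j: "j = (s, b)" "0 \<le> s" "b \<in> C"
      using ij by (auto simp: I_def)
    \<comment> \<open>Convexity merges the two multiples into one of a single point of
      \<open>C\<close>. If both weights vanish, any point of \<open>C\<close> serves.\<close>
    obtain a where a: "a \<in> C" "(t + s) *\<^sub>R a = t *\<^sub>R c + s *\<^sub>R b"
    proof (cases "t + s = 0")
      case True
      then have "t = 0" "s = 0"
        using i j by auto
      then show ?thesis
        using that[OF i(3)] by simp
    next
      case False
      show ?thesis
      proof (rule that)
        show "(t / (t + s)) *\<^sub>R c + (s / (t + s)) *\<^sub>R b \<in> C"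
          using convexD[OF C(1) i(3) j(3), of "t / (t + s)" "s / (t + s)"] False i j
          by (simp add: add_divide_distrib[symmetric])
        show "(t + s) *\<^sub>R ((t / (t + s)) *\<^sub>R c + (s / (t + s)) *\<^sub>R b) = t *\<^sub>R c + s *\<^sub>R b"
          using False by (simp add: scaleR_add_right)
      qed
    qed
    have "q (x + y) \<le> p ((x + y) + (t + s) *\<^sub>R a) - (t + s) * d"
      using i j a(1) by (intro le) auto
    also have "(x + y) + (t + s) *\<^sub>R a = (x + t *\<^sub>R c) + (y + s *\<^sub>R b)"
      unfolding a by simp
    also have "p \<dots> \<le> p (x + t *\<^sub>R c) + p (y + s *\<^sub>R b)"
      by (rule sublinear_add[OF p])
    finally show ?thesis
      by (simp add: g_def i j algebra_simps)
  qed
  then have "q (x + y) - g y j \<le> q x" if "j \<in> I" for x y j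
    unfolding q_def[of x] using that I by (intro cINF_greatest) (auto simp: algebra_simps)
  then have "q (x + y) - q x \<le> q y" for x y
    unfolding q_def[of y] using I by (intro cINF_greatest) (auto simp: algebra_simps)
  moreover have "q (r *\<^sub>R x) \<le> r * q x" if "0 < r" for r x
  proof -
    have "q (r *\<^sub>R x) / r \<le> g x i" if "i \<in> I" for i
    proof -
      from that obtain t c where i: "i = (t, c)" "0 \<le> t" "c \<in> C"
        by (auto simp: I_def)
      have "q (r *\<^sub>R x) \<le> p (r *\<^sub>R (x + t *\<^sub>R c)) - r * t * d"
        using le[of "r * t" c "r *\<^sub>R x"] i \<open>0 < r\<close> by (simp add: scaleR_add_right)
      also have "\<dots> = r * g x i"
        using sublinear_scale[OF p, of r "x + t *\<^sub>R c"] \<open>0 < r\<close>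
        by (simp add: g_def i right_diff_distrib)
      finally show ?thesis
        using \<open>0 < r\<close> by (simp add: field_simps)
    qed
    then have "q (r *\<^sub>R x) / r \<le> q x"
      unfolding q_def[of x] using I by (intro cINF_greatest)
    then show ?thesis
      using \<open>0 < r\<close> by (simp add: field_simps)
  qed
  ultimately show "sublinear q"
    by (auto simp: sublinear_def algebra_simps)
qed

text \<open>A minimal sublinear functional below \<open>p\<close> is linear, so Zorn's lemma applies to functionals
  defined on the whole space and no partial extensions are needed.\<close>

theorem hahn_banach:
  assumes p: "sublinear p"
  obtains f where "linear f" "\<And>x. f x \<le> p x"
proof -
  define S where "S = {q. sublinear q \<and> q \<le> p}"
  define R where "R = relation_of (\<lambda>q r. r \<le> q) S"
  \<comment> \<open>The order is reversed, so that Zorn's lemma yields a minimal element; the bound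
    of a chain is its pointwise infimum.\<close>
  have "\<exists>q\<in>S. \<forall>r\<in>S. r \<le> q \<longrightarrow> r = q"
  proof (rule predicate_Zorn)
    show "partial_order_on S (relation_of (\<lambda>q r. r \<le> q) S)"
      by (rule partial_order_on_relation_ofI) auto
  next
    fix Q assume Q: "Q \<in> Chains (relation_of (\<lambda>q r. r \<le> q) S)"
    have QS: "q \<in> S" and lin: "q \<le> r \<or> r \<le> q" if "q \<in> Q" "r \<in> Q" for q r
      using Q that by (auto simp: Chains_def relation_of_def)
    show "\<exists>u\<in>S. \<forall>q\<in>Q. u \<le> q"
    proof (cases "Q = {}")
      case True
      then show ?thesis
        using p by (auto simp: S_def)
    next
      case False
      define u where "u x = (INF q\<in>Q. q x)" for x
      have "- p (- x) \<le> q x" if "q \<in> Q" for q x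
      proof -
        have "q (- x) \<le> p (- x)" "- q (- x) \<le> q x"
          using QS[OF that that] sublinear_minus[of q x] by (auto simp: S_def le_fun_def)
        then show ?thesis
          by simp
      qed
      then have bdd: "bdd_below ((\<lambda>q. q x) ` Q)" for x
        by (intro bdd_belowI2)
      have le: "u x \<le> q x" if "q \<in> Q" for q x
        unfolding u_def using that by (intro cINF_lower bdd)
      have "u (x + y) \<le> q x + r y" if qr: "q \<in> Q" "r \<in> Q" for q r x y
      proof -
        \<comment> \<open>Subadditivity survives the infimum because two members of a chain have a
          common lower one.\<close>
        obtain s where s: "s \<in> Q" "s \<le> q" "s \<le> r"
          using lin[OF qr] qr by auto
        have "u (x + y) \<le> s (x + y)"
          by (rule le[OF s(1)])
        also have "\<dots> \<le> s x + s y"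
          using QS[OF s(1) s(1)] sublinear_add by (auto simp: S_def)
        also have "\<dots> \<le> q x + r y"
          using s(2,3) by (auto simp: le_fun_def intro: add_mono)
        finally show ?thesis .
      qed
      then have "u (x + y) - r y \<le> u x" if "r \<in> Q" for r x y
        unfolding u_def[of x] using that False by (intro cINF_greatest) (auto simp: algebra_simps)
      then have "u (x + y) - u x \<le> u y" for x y
        unfolding u_def[of y] using False by (intro cINF_greatest) (auto simp: algebra_simps)
      moreover have "u (c *\<^sub>R x) \<le> c * u x" if "0 < c" for c x
      proof -
        have "u (c *\<^sub>R x) / c \<le> q x" if "q \<in> Q" for q
          using le[OF that, of "c *\<^sub>R x"] QS[OF that that] \<open>0 < c\<close>
          by (auto simp: S_def sublinear_scale field_simps)
        then have "u (c *\<^sub>R x) / c \<le> u x"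
          unfolding u_def[of x] using False by (intro cINF_greatest)
        then show ?thesis
          using \<open>0 < c\<close> by (simp add: field_simps)
      qed
      ultimately have "sublinear u"
        by (auto simp: sublinear_def algebra_simps)
      moreover have "u \<le> p"
      proof -
        obtain q where "q \<in> Q" using False by auto
        then show ?thesis
          using le[of q] QS[of q q] by (auto simp: S_def le_fun_def intro: order_trans)
      qed
      ultimately show ?thesis
        using le by (auto simp: S_def le_fun_def)
    qed
  qed
  then obtain q where q: "sublinear q" "q \<le> p" and min: "\<And>r. sublinear r \<Longrightarrow> r \<le> q \<Longrightarrow> r = q"
    by (auto simp: S_def)
  \<comment> \<open>Shrinking \<open>q\<close> along \<open>{y}\<close> with \<open>d = q y\<close>
    cannot change it, by minimality. An odd sublinear functional is linear.\<close>
  have odd: "q (- y) = - q y" for y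
  proof -
    obtain r where r: "sublinear r" "\<And>x. r x \<le> q x" "\<And>c. c \<in> {y} \<Longrightarrow> r (- c) \<le> - q y"
      by (rule sublinear_shrink[of q "{y}" "q y"]) (use q in auto)
    have "r = q"
      using min r by (simp add: le_fun_def)
    then show ?thesis
      using r(3)[of y] sublinear_minus[OF q(1), of y] by simp
  qed
  have "linear q"
  proof (rule linearI)
    show "q (x + y) = q x + q y" for x y
      using sublinear_add[OF q(1), of x y] sublinear_add[OF q(1), of "x + y" "- y"] odd[of y] by simp
    show "q (c *\<^sub>R x) = c *\<^sub>R q x" for c x
      using sublinear_scale[OF q(1), of c x] sublinear_scale[OF q(1), of "- c" x] odd[of "c *\<^sub>R x"]
      by (cases "0 \<le> c") auto
  qed
  with q(2) show ?thesis
    by (intro that) (auto simp: le_fun_def)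
qed

lemma bounded_linear_dominated:
  fixes f :: "'a::real_normed_vector \<Rightarrow> real"
  assumes "linear f" and le: "\<And>x. f x \<le> M * norm x"
  shows "bounded_linear f"
proof (rule bounded_linear_intro)
  show "f (x + y) = f x + f y" "f (c *\<^sub>R x) = c *\<^sub>R f x" for x y c
    using assms(1) by (simp_all add: linear_add linear_scale)
  show "norm (f x) \<le> norm x * M" for x
    using le[of x] le[of "- x"] linear_neg[OF assms(1), of x] by (simp add: abs_le_iff mult.commute)
qed

section \<open>Separation of convex sets\<close>

text \<open>Shrink the norm along \<open>C\<close> and take a linear functional below the result:
  staying below the norm bounds its operator norm by 1.\<close>

lemma separation_from_0:
  fixes C :: "'a::real_normed_vector set"
  assumes "convex C" "C \<noteq> {}" and d: "\<And>c. c \<in> C \<Longrightarrow> d \<le> norm c"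
  obtains \<phi> :: "'a \<Rightarrow>\<^sub>L real" where "norm \<phi> \<le> 1" "\<And>c. c \<in> C \<Longrightarrow> d \<le> \<phi> c"
proof -
  obtain q :: "'a \<Rightarrow> real" where q: "sublinear q" "\<And>x. q x \<le> norm x" "\<And>c. c \<in> C \<Longrightarrow> q (- c) \<le> - d"
    using sublinear_shrink[OF sublinear_norm assms] by blast
  obtain f where f: "linear f" "\<And>x. f x \<le> q x"
    using hahn_banach[OF q(1)] by blast
  have le: "f x \<le> norm x" for x
    using f(2) q(2) order_trans by blast
  have bl: "bounded_linear f"
    using bounded_linear_dominated[OF f(1), of 1] le by simp
  show ?thesis
  proof (rule that)
    show "norm (Blinfun f) \<le> 1"
      using le le[of "- x" for x] linear_neg[OF f(1)]
      by (intro norm_blinfun_bound) (auto simp: bounded_linear_Blinfun_apply[OF bl] abs_le_iff)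
    show "d \<le> Blinfun f c" if "c \<in> C" for c
      using q(3)[OF that] f(2)[of "- c"] linear_neg[OF f(1), of c]
      by (simp add: bounded_linear_Blinfun_apply[OF bl])
  qed
qed

text \<open>Translate the cone generated by \<open>A - x\<close> by \<open>b - x\<close>, with
  \<open>b\<close> interior to \<open>A\<close>. The result \<open>C\<close> keeps distance
  \<open>r\<close> from 0, and a functional bounded below on it cannot be negative on any direction
  of the cone.\<close>

lemma supporting_functional:
  fixes A :: "'a::real_normed_vector set"
  assumes A: "convex A" "interior A \<noteq> {}" and x: "x \<notin> interior A"
  obtains \<phi> :: "'a \<Rightarrow>\<^sub>L real" where "\<phi> \<noteq> 0" "\<And>a. a \<in> A \<Longrightarrow> \<phi> x \<le> \<phi> a"
proof -
  obtain b where b: "b \<in> interior A"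
    using A by auto
  then obtain r where r: "0 < r" "ball b r \<subseteq> interior A"
    using open_interior open_contains_ball by blast
  define C where "C = (\<lambda>(s, a). (b - x) + s *\<^sub>R (a - x)) ` ({0::real..} \<times> A)"
  have Cne: "C \<noteq> {}"
    using b interior_subset by (auto simp: C_def)
  have "convex C"
  proof (rule convexI)
    fix c1 c2 and u v :: real
    assume c: "c1 \<in> C" "c2 \<in> C" and uv: "0 \<le> u" "0 \<le> v" "u + v = 1"
    obtain s1 a1 where 1: "c1 = (b - x) + s1 *\<^sub>R (a1 - x)" "0 \<le> s1" "a1 \<in> A"
      using c by (auto simp: C_def)
    obtain s2 a2 where 2: "c2 = (b - x) + s2 *\<^sub>R (a2 - x)" "0 \<le> s2" "a2 \<in> A"
      using c by (auto simp: C_def)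
    define s where "s = u * s1 + v * s2"
    have nn: "0 \<le> u * s1" "0 \<le> v * s2"
      using 1 2 uv by auto
    have e: "u *\<^sub>R c1 + v *\<^sub>R c2 = (b - x) + ((u * s1) *\<^sub>R a1 + (v * s2) *\<^sub>R a2 - s *\<^sub>R x)"
    proof -
      have v: "v = 1 - u"
        using uv by simp
      show ?thesis
        unfolding 1 2 s_def v by (simp add: algebra_simps)
    qed
    show "u *\<^sub>R c1 + v *\<^sub>R c2 \<in> C"
    \<comment> \<open>For \<open>s = 0\<close> both points are the vertex \<open>b - x\<close>, and
      the weights divided by \<open>s\<close> would be meaningless.\<close>
    proof (cases "s = 0")
      case True
      then have "u * s1 = 0" "v * s2 = 0"
        using nn unfolding s_def by linarith+
      then have "u *\<^sub>R c1 + v *\<^sub>R c2 = (\<lambda>(s, a). (b - x) + s *\<^sub>R (a - x)) (0, a1)"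
        using e unfolding \<open>u * s1 = 0\<close> \<open>v * s2 = 0\<close> True by simp
      then show ?thesis
        unfolding C_def by (rule image_eqI) (use 1(3) in auto)
    next
      case False
      let ?a = "(u * s1 / s) *\<^sub>R a1 + (v * s2 / s) *\<^sub>R a2"
      have "s > 0" using False nn by (simp add: s_def)
      then have a: "?a \<in> A"
        using 1 2 nn by (intro convexD[OF A(1)]) (auto simp: s_def add_divide_distrib[symmetric])
      have "u *\<^sub>R c1 + v *\<^sub>R c2 = (\<lambda>(s, a). (b - x) + s *\<^sub>R (a - x)) (s, ?a)"
        using e False by (simp add: scaleR_diff_right scaleR_add_right)
      then show ?thesis
        unfolding C_def by (rule image_eqI) (use \<open>s > 0\<close> a in auto)
    qed
  qed
  moreover have "r \<le> norm c" if c: "c \<in> C" for c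
  proof (rule ccontr)
    assume "\<not> r \<le> norm c"
    moreover obtain s a where a: "c = (b - x) + s *\<^sub>R (a - x)" "0 \<le> s" "a \<in> A"
      using c by (auto simp: C_def)
    \<comment> \<open>This point differs from \<open>b\<close> by \<open>c\<close>, hence is
      interior to \<open>A\<close>. As \<open>x\<close> lies between it and \<open>a\<close>, with
      positive weight \<open>l\<close> on it, \<open>x\<close> would be interior as well.\<close>
    ultimately have "x - s *\<^sub>R (a - x) \<in> ball b r"
      by (simp add: dist_norm algebra_simps)
    then have y: "x - s *\<^sub>R (a - x) \<in> interior A"
      using r by auto
    define l where "l = 1 / (1 + s)"
    have l: "0 < l" "l \<le> 1" "l * s = 1 - l"
      using a(2) by (auto simp: l_def field_simps)
    let ?T = "(\<lambda>z. (1 - l) *\<^sub>R a + l *\<^sub>R z) ` interior A"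
    have "open ?T"
      using l(1) by (intro open_affinity) auto
    moreover have "?T \<subseteq> A"
      using A(1) a(3) l interior_subset[of A] by (auto intro!: convexD)
    moreover have "x \<in> ?T"
    proof (rule image_eqI[OF _ y])
      have "(1 - l) *\<^sub>R a + l *\<^sub>R (x - s *\<^sub>R (a - x)) = (1 - l) *\<^sub>R a + l *\<^sub>R x - (l * s) *\<^sub>R (a - x)"
        by (simp add: scaleR_diff_right)
      then show "x = (1 - l) *\<^sub>R a + l *\<^sub>R (x - s *\<^sub>R (a - x))"
        by (simp add: l(3) algebra_simps)
    qed
    ultimately show False
      using x interior_maximal by blast
  qed
  ultimately obtain \<phi> :: "'a \<Rightarrow>\<^sub>L real" where \<phi>: "\<And>c. c \<in> C \<Longrightarrow> r \<le> \<phi> c"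
    using separation_from_0[of C r] Cne by blast
  have *: "r \<le> \<phi> (b - x) + s * \<phi> (a - x)" if "0 \<le> s" "a \<in> A" for s a
    using \<phi>[of "(b - x) + s *\<^sub>R (a - x)"] that by (force simp: C_def blinfun.bilinear_simps)
  show ?thesis
  proof
    show "\<phi> \<noteq> 0"
      using *[of 0 b] b interior_subset[of A] r by auto
    show "\<phi> x \<le> \<phi> a" if "a \<in> A" for a
    proof (rule ccontr)
      assume "\<not> \<phi> x \<le> \<phi> a"
      then have neg: "\<phi> (a - x) < 0"
        by (simp add: blinfun.diff_right)
      \<comment> \<open>This factor makes the cone term cancel \<open>\<phi> (b - x)\<close> or
        more, contradicting the bound \<open>r > 0\<close>.\<close>
      define s where "s = \<bar>\<phi> (b - x)\<bar> / - \<phi> (a - x)"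
      have "s \<ge> 0" "s * \<phi> (a - x) = - \<bar>\<phi> (b - x)\<bar>"
        using neg by (auto simp: s_def field_simps)
      then show False
        using *[of s a] that r by auto
    qed
  qed
qed

section \<open>Reflexive spaces\<close>

lemma bidual_embedding_apply [simp]: "bidual_embedding x \<phi> = blinfun_apply \<phi> x"
  unfolding bidual_embedding_def
  by (subst bounded_linear_Blinfun_apply) (auto intro: bounded_linear_intros)

lemma bidual_embedding_diff: "bidual_embedding (x - y) = bidual_embedding x - bidual_embedding y"
  by (rule blinfun_eqI) (simp add: blinfun.bilinear_simps)

text \<open>The lower bound needs a norming functional, found by separating \<open>{x}\<close> from
  0.\<close>

lemma norm_bidual_embedding:
  fixes x :: "'a::real_normed_vector"
  shows "norm (bidual_embedding x) = norm x"
proof (rule antisym)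
  have "norm (\<phi> x) \<le> norm x * norm \<phi>" for \<phi> :: "'a \<Rightarrow>\<^sub>L real"
    using norm_blinfun[of \<phi> x] by (simp add: mult.commute)
  then show "norm (bidual_embedding x) \<le> norm x"
    by (intro norm_blinfun_bound) auto
  obtain \<phi> :: "'a \<Rightarrow>\<^sub>L real" where "norm \<phi> \<le> 1" "norm x \<le> \<phi> x"
    using separation_from_0[of "{x}" "norm x"] by auto
  then show "norm x \<le> norm (bidual_embedding x)"
    using norm_blinfun[of "bidual_embedding x" \<phi>] mult_left_le[of "norm \<phi>" "norm (bidual_embedding x)"]
    by auto
qed

lemma dist_bidual_embedding: "dist (bidual_embedding x) (bidual_embedding y) = dist x y"
  by (simp add: dist_norm bidual_embedding_diff[symmetric] norm_bidual_embedding)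

text \<open>Restrict \<open>F\<close> to evaluations at points of the space. Since every element of
  the bidual is such an evaluation, \<open>F\<close> is evaluation at that restriction.\<close>

lemma reflexive_dual:
  assumes "reflexive TYPE('a::real_normed_vector)"
  shows "reflexive TYPE('a \<Rightarrow>\<^sub>L real)"
  unfolding reflexive_def
proof (rule surjI)
  fix F :: "(('a \<Rightarrow>\<^sub>L real) \<Rightarrow>\<^sub>L real) \<Rightarrow>\<^sub>L real"
  have bl: "bounded_linear (\<lambda>x::'a. F (bidual_embedding x))"
  proof (rule bounded_linear_compose[OF blinfun.bounded_linear_right])
    show "bounded_linear (bidual_embedding :: 'a \<Rightarrow> _)"
    proof (rule bounded_linear_intro)
      show "norm (bidual_embedding x) \<le> norm x * 1" for x :: 'a
        by (simp add: norm_bidual_embedding)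
    qed (auto intro!: blinfun_eqI simp: blinfun.bilinear_simps)
  qed
  show "bidual_embedding (Blinfun (\<lambda>x. F (bidual_embedding x))) = F"
  proof (rule blinfun_eqI)
    fix G :: "('a \<Rightarrow>\<^sub>L real) \<Rightarrow>\<^sub>L real"
    obtain x where "G = bidual_embedding x"
      using assms by (auto simp: reflexive_def)
    then show "bidual_embedding (Blinfun (\<lambda>x. F (bidual_embedding x))) G = F G"
      by (simp add: bounded_linear_Blinfun_apply[OF bl])
  qed
qed

text \<open>This takes the place of weak compactness. The limit \<open>p\<close> of the support
  functions of the sets is sublinear; a linear functional below it is bounded, hence represented by
  a point, which separation places in every \<open>C n\<close>.\<close>

lemma reflexive_Inter_nonempty:
  fixes C :: "nat \<Rightarrow> 'a::real_normed_vector set"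
  assumes refl: "reflexive TYPE('a)" and "decseq C" and bdd: "bounded (C 0)"
    and C: "\<And>n. closed (C n)" "\<And>n. convex (C n)" "\<And>n. C n \<noteq> {}"
  obtains x where "\<And>n. x \<in> C n"
proof -
  define S where "S \<phi> n = (SUP x\<in>C n. blinfun_apply \<phi> x)" for \<phi> :: "'a \<Rightarrow>\<^sub>L real" and n
  define p where "p \<phi> = (INF n. S \<phi> n)" for \<phi>
  have dec: "C n \<subseteq> C m" if "m \<le> n" for m n
    using assms(2) that by (simp add: decseq_def)
  obtain M where M: "\<And>x. x \<in> C 0 \<Longrightarrow> norm x \<le> M"
    using bdd by (auto simp: bounded_iff)
  have abs: "\<bar>\<phi> x\<bar> \<le> M * norm \<phi>" if "x \<in> C n" for \<phi> :: "'a \<Rightarrow>\<^sub>L real" and x n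
  proof -
    have "\<bar>\<phi> x\<bar> \<le> norm \<phi> * norm x"
      using norm_blinfun[of \<phi> x] by simp
    also have "\<dots> \<le> norm \<phi> * M"
      using M dec[of 0 n] that by (intro mult_left_mono) auto
    finally show ?thesis
      by (simp add: mult.commute)
  qed
  have bddS: "bdd_above (blinfun_apply \<phi> ` C n)" for \<phi> :: "'a \<Rightarrow>\<^sub>L real" and n
    using abs[of _ n \<phi>] by (intro bdd_aboveI2[where M = "M * norm \<phi>"]) (auto simp: abs_le_iff)
  have S_ge: "\<phi> x \<le> S \<phi> n" if "x \<in> C n" for \<phi> :: "'a \<Rightarrow>\<^sub>L real" and x n
    unfolding S_def by (rule cSUP_upper[OF that bddS])
  have S_le: "S \<phi> n \<le> B" if "\<And>x. x \<in> C n \<Longrightarrow> \<phi> x \<le> B" for \<phi> :: "'a \<Rightarrow>\<^sub>L real" and n B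
    unfolding S_def using C that by (intro cSUP_least) auto
  have bddp: "bdd_below (range (S \<phi>))" for \<phi>
  proof (rule bdd_belowI2)
    fix n
    obtain x where "x \<in> C n"
      using C(3)[of n] by blast
    then show "- (M * norm \<phi>) \<le> S \<phi> n"
      using abs[of x n \<phi>] S_ge[of x n \<phi>] by (simp add: abs_le_iff)
  qed
  have p_le: "p \<phi> \<le> S \<phi> n" for \<phi> n
    unfolding p_def by (intro cINF_lower bddp) simp
  have S_mono: "S \<phi> n \<le> S \<phi> m" if "m \<le> n" for \<phi> m n
    using dec[OF that] S_ge by (intro S_le) auto
  have "p (\<phi> + \<psi>) \<le> S \<phi> m + S \<psi> n" for \<phi> \<psi> m n
  proof -
    \<comment> \<open>Support functions decrease with the index, so the larger index serves both
      summands.\<close>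
    have "p (\<phi> + \<psi>) \<le> S (\<phi> + \<psi>) (max m n)"
      by (rule p_le)
    also have "\<dots> \<le> S \<phi> (max m n) + S \<psi> (max m n)"
      by (intro S_le) (auto simp: blinfun.bilinear_simps intro: add_mono S_ge)
    also have "\<dots> \<le> S \<phi> m + S \<psi> n"
      by (intro add_mono S_mono) auto
    finally show ?thesis .
  qed
  then have "p (\<phi> + \<psi>) - S \<psi> n \<le> p \<phi>" for \<phi> \<psi> n
    unfolding p_def[of \<phi>] by (intro cINF_greatest) (auto simp: algebra_simps)
  then have "p (\<phi> + \<psi>) - p \<phi> \<le> p \<psi>" for \<phi> \<psi>
    unfolding p_def[of \<psi>] by (intro cINF_greatest) (auto simp: algebra_simps)
  moreover have "p (c *\<^sub>R \<phi>) \<le> c * p \<phi>" if "0 < c" for c \<phi>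
  proof -
    have "p (c *\<^sub>R \<phi>) / c \<le> S \<phi> n" for n
    proof -
      have "p (c *\<^sub>R \<phi>) \<le> S (c *\<^sub>R \<phi>) n"
        by (rule p_le)
      also have "\<dots> \<le> c * S \<phi> n"
        using that S_ge by (intro S_le) (auto simp: blinfun.bilinear_simps)
      finally show ?thesis
        using that by (simp add: field_simps)
    qed
    then have "p (c *\<^sub>R \<phi>) / c \<le> p \<phi>"
      unfolding p_def[of \<phi>] by (intro cINF_greatest) auto
    then show ?thesis
      using that by (simp add: field_simps)
  qed
  ultimately have "sublinear p"
    by (auto simp: sublinear_def algebra_simps)
  then obtain F where F: "linear F" "\<And>\<phi>. F \<phi> \<le> p \<phi>"
    using hahn_banach by blast
  have "F \<phi> \<le> M * norm \<phi>" for \<phi>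
  proof -
    have "S \<phi> 0 \<le> M * norm \<phi>"
      using abs[of _ 0 \<phi>] by (intro S_le) (auto simp: abs_le_iff)
    then show ?thesis
      using F(2)[of \<phi>] p_le[of \<phi> 0] by simp
  qed
  then have bl: "bounded_linear F"
    by (rule bounded_linear_dominated[OF F(1)])
  obtain x where x: "Blinfun F = bidual_embedding x"
    using refl by (auto simp: reflexive_def)
  have x_le: "\<phi> x \<le> S \<phi> n" for \<phi> :: "'a \<Rightarrow>\<^sub>L real" and n
    using F(2)[of \<phi>] p_le[of \<phi> n] arg_cong[OF x, of "\<lambda>G. blinfun_apply G \<phi>"]
    by (simp add: bounded_linear_Blinfun_apply[OF bl])
  show ?thesis
  proof
    show "x \<in> C n" for n
    proof (rule ccontr)
      assume "x \<notin> C n"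
      then have "x \<in> - C n" "open (- C n)"
        using C by auto
      then obtain d where d: "0 < d" "ball x d \<subseteq> - C n"
        using open_contains_ball by blast
      let ?A = "(\<lambda>c. x - c) ` C n"
      have "convex ?A"
        using convex_affinity[OF C(2)[of n], of x "-1"] by simp
      moreover have "d \<le> norm a" if "a \<in> ?A" for a
        using that d by (force simp: dist_norm)
      ultimately obtain \<phi> :: "'a \<Rightarrow>\<^sub>L real" where \<phi>: "\<And>a. a \<in> ?A \<Longrightarrow> d \<le> \<phi> a"
        using separation_from_0[of ?A d] C(3)[of n] by blast
      have "S \<phi> n \<le> \<phi> x - d"
        using \<phi> by (intro S_le) (force simp: blinfun.bilinear_simps)
      then show False
        using x_le[of \<phi> n] d by simp
    qed
  qed
qed

section \<open>Differentiable convex functions\<close>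

lemma gateaux_derivative_unique:
  assumes "has_gateaux_derivative \<Psi> \<phi> x" "has_gateaux_derivative \<Psi> \<psi> x"
  shows "\<phi> = \<psi>"
proof (rule blinfun_eqI)
  show "\<phi> h = \<psi> h" for h
    using assms unfolding has_gateaux_derivative_def
    by (meson LIM_unique)
qed

lemma gateaux_derivative_eqI: "has_gateaux_derivative \<Psi> \<phi> x \<Longrightarrow> gateaux_derivative \<Psi> x = \<phi>"
  unfolding gateaux_derivative_def using gateaux_derivative_unique by blast

lemma has_derivative_directional:
  fixes f :: "'a::real_normed_vector \<Rightarrow> real"
  assumes "(f has_derivative D) (at x)"
  shows "((\<lambda>t. (f (x + t *\<^sub>R h) - f x) / t) \<longlongrightarrow> D h) (at 0)"
proof -
  have "((\<lambda>t. x + t *\<^sub>R h) has_derivative (\<lambda>t. t *\<^sub>R h)) (at 0)"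
    by (auto intro!: derivative_eq_intros)
  moreover have "(f has_derivative D) (at (x + 0 *\<^sub>R h))"
    using assms by simp
  ultimately have "((\<lambda>t. f (x + t *\<^sub>R h)) has_derivative (\<lambda>t. D (t *\<^sub>R h))) (at 0)"
    by (rule has_derivative_compose)
  moreover have "(\<lambda>t. D (t *\<^sub>R h)) = (*) (D h)"
    using has_derivative_linear[OF assms] by (auto simp: linear_scale)
  ultimately have "((\<lambda>t. f (x + t *\<^sub>R h)) has_field_derivative D h) (at 0)"
    by (simp add: has_field_derivative_def)
  then show ?thesis
    by (simp add: has_field_derivative_iff)
qed

lemma has_derivative_imp_gateaux:
  assumes "((\<lambda>z. real_of_ereal (\<Psi> z)) has_derivative blinfun_apply \<phi>) (at x)"
  shows "has_gateaux_derivative \<Psi> \<phi> x"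
  unfolding has_gateaux_derivative_def using has_derivative_directional[OF assms] by blast

text \<open>Used for \<open>\<Psi>\<close> and again for \<open>conjugate \<Psi>\<close>, where
  points are functionals and derivatives lie in the bidual.\<close>

locale frechet_convex =
  fixes \<Psi> :: "'a::real_normed_vector \<Rightarrow> ereal"
  assumes proper: "proper_fun \<Psi>" and convex: "convex_fun \<Psi>"
    and frechet: "frechet_differentiable_on_int_dom \<Psi>"
begin

abbreviation G :: "'a set" where "G \<equiv> interior (edom \<Psi>)"

abbreviation D :: "'a \<Rightarrow> 'a \<Rightarrow>\<^sub>L real" where "D \<equiv> gateaux_derivative \<Psi>"

text \<open>Off the domain the value is the default 0, so statements about \<open>f\<close> are
  restricted to \<open>edom \<Psi>\<close>.\<close>

definition f :: "'a \<Rightarrow> real" where "f x = real_of_ereal (\<Psi> x)"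

lemma Psi_eq: "x \<in> edom \<Psi> \<Longrightarrow> \<Psi> x = ereal (f x)"
  using proper by (cases "\<Psi> x") (auto simp: proper_fun_def edom_def f_def)

lemma Psi_eq_infinity: "x \<notin> edom \<Psi> \<Longrightarrow> \<Psi> x = \<infinity>"
  by (simp add: edom_def)

lemma G_subset: "x \<in> G \<Longrightarrow> x \<in> edom \<Psi>"
  using interior_subset by blast

lemma
  assumes "x \<in> edom \<Psi>" "y \<in> edom \<Psi>" "0 < u" "u < 1"
  shows combination_edom: "(1 - u) *\<^sub>R x + u *\<^sub>R y \<in> edom \<Psi>" (is "?z \<in> _")
    and f_combination: "f ((1 - u) *\<^sub>R x + u *\<^sub>R y) \<le> (1 - u) * f x + u * f y"
proof -
  have le: "\<Psi> ?z \<le> ereal ((1 - u) * f x + u * f y)"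
    using convex assms(3,4) Psi_eq[OF assms(1)] Psi_eq[OF assms(2)]
    unfolding convex_fun_def by (metis plus_ereal.simps(1) times_ereal.simps(1))
  then show z: "?z \<in> edom \<Psi>"
    by (auto simp: edom_def)
  show "f ?z \<le> (1 - u) * f x + u * f y"
    using le by (simp add: Psi_eq[OF z])
qed

lemma convex_edom: "convex (edom \<Psi>)"
  unfolding convex_alt
proof (intro ballI allI impI)
  fix x y and u :: real
  assume "x \<in> edom \<Psi>" "y \<in> edom \<Psi>" "0 \<le> u \<and> u \<le> 1"
  then show "(1 - u) *\<^sub>R x + u *\<^sub>R y \<in> edom \<Psi>"
    using combination_edom[of x y u] by (cases "u = 0 \<or> u = 1") auto
qed

lemma f_convex: "convex_on (edom \<Psi>) f"
  by (rule convex_onI) (auto intro: f_combination convex_edom)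

lemma D_frechet:
  assumes "x \<in> G"
  shows "(f has_derivative blinfun_apply (D x)) (at x)"
proof -
  obtain f' where f': "(f has_derivative f') (at x)"
    using frechet assms
    by (auto simp: frechet_differentiable_on_int_dom_def differentiable_def f_def[abs_def])
  then have *: "(f has_derivative blinfun_apply (Blinfun f')) (at x)"
    using bounded_linear_Blinfun_apply[OF has_derivative_bounded_linear[OF f']] by simp
  then have "D x = Blinfun f'"
    by (intro gateaux_derivative_eqI has_derivative_imp_gateaux) (simp add: f_def[abs_def])
  with * show ?thesis
    by simp
qed

lemma f_continuous: "x \<in> G \<Longrightarrow> isCont f x"
  using D_frechet has_derivative_continuous by blast

lemma directional:
  assumes "x \<in> G"
  shows "((\<lambda>t. (f (x + t *\<^sub>R h) - f x) / t) \<longlongrightarrow> D x h) (at_right 0)"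
  using has_derivative_directional[OF D_frechet[OF assms]] filterlim_mono[OF _ order_refl at_le]
  by blast

text \<open>Convexity bounds the difference quotients on the segment to \<open>z\<close> by
  \<open>f z - f x\<close>; let the step tend to 0.\<close>

lemma subgradient:
  assumes x: "x \<in> G" and z: "z \<in> edom \<Psi>"
  shows "f x + D x (z - x) \<le> f z"
proof -
  have "(f (x + t *\<^sub>R (z - x)) - f x) / t \<le> f z - f x" if "t \<in> {0<..<1}" for t
  proof -
    have "x + t *\<^sub>R (z - x) = (1 - t) *\<^sub>R x + t *\<^sub>R z"
      by (simp add: algebra_simps)
    then show ?thesis
      using f_combination[OF G_subset[OF x] z, of t] that by (simp add: field_simps)
  qed
  then have "eventually (\<lambda>t. (f (x + t *\<^sub>R (z - x)) - f x) / t \<le> f z - f x) (at_right 0)"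
    using eventually_at_right_real[of 0 1] by (auto elim: eventually_mono)
  then have "D x (z - x) \<le> f z - f x"
    by (intro tendsto_upperbound[OF directional[OF x]]) auto
  then show ?thesis
    by simp
qed

text \<open>A subgradient is below every directional derivative; the directions \<open>h\<close> and
  \<open>- h\<close> together give equality. This later identifies the derivative of the
  conjugate.\<close>

lemma subgradient_unique:
  assumes x: "x \<in> G" and \<phi>: "\<And>z. z \<in> edom \<Psi> \<Longrightarrow> f x + blinfun_apply \<phi> (z - x) \<le> f z"
  shows "\<phi> = D x"
proof -
  have le: "\<phi> h \<le> D x h" for h
  proof (rule tendsto_lowerbound[OF directional[OF x]])
    have "((\<lambda>t. x + t *\<^sub>R h) \<longlongrightarrow> x + 0 *\<^sub>R h) (at_right 0)"
      by (intro tendsto_intros)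
    then have "eventually (\<lambda>t. x + t *\<^sub>R h \<in> G) (at_right 0)"
      using x by (auto dest: topological_tendstoD[OF _ open_interior])
    then show "eventually (\<lambda>t. \<phi> h \<le> (f (x + t *\<^sub>R h) - f x) / t) (at_right 0)"
      using eventually_at_right_less[of "0::real"]
    proof eventually_elim
      case (elim t)
      then show ?case
        using \<phi>[OF G_subset, of "x + t *\<^sub>R h"] by (simp add: blinfun.scaleR_right field_simps)
    qed
  qed simp
  show ?thesis
  proof (rule blinfun_eqI)
    show "\<phi> h = D x h" for h
      using le[of h] le[of "- h"] by (simp add: blinfun.minus_right)
  qed
qed

text \<open>For \<open>\<parallel>h\<parallel>\<close> comparable to the distance to \<open>x\<^sub>0\<close>, both \<open>x\<close> and \<open>x + h\<close> lie in the region
  where \<open>f\<close> is close to its first-order expansion at \<open>x\<^sub>0\<close>, and the subgradient inequality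
  at \<open>x\<close> turns this into a bound on \<open>D x - D x\<^sub>0\<close>.\<close>

lemma D_continuous: "continuous_on G D"
  unfolding continuous_on_iff
proof (intro ballI allI impI)
  fix x0 and e :: real
  assume x0: "x0 \<in> G" and e: "0 < e"
  obtain d where d: "0 < d"
    and small: "\<And>y. norm (y - x0) < d \<Longrightarrow> \<bar>f y - f x0 - D x0 (y - x0)\<bar> \<le> e / 8 * norm (y - x0)"
    using D_frechet[OF x0] e unfolding has_derivative_at_alt real_norm_def
    by (metis zero_less_divide_iff zero_less_numeral)
  obtain r where r: "0 < r" "ball x0 r \<subseteq> G"
    using x0 open_contains_ball open_interior by blast
  \<comment> \<open>With \<open>k\<close> of norm \<open>\<eta>\<close>, the point
    \<open>x + k\<close> stays within \<open>2 * \<eta>\<close> of \<open>x0\<close>, inside both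
    balls.\<close>
  define \<eta> where "\<eta> = min d r / 4"
  have \<eta>: "0 < \<eta>" "4 * \<eta> \<le> d" "4 * \<eta> \<le> r"
    using d r by (auto simp: \<eta>_def)
  show "\<exists>d>0. \<forall>x\<in>G. dist x x0 < d \<longrightarrow> dist (D x) (D x0) < e"
  proof (intro exI[of _ \<eta>] conjI ballI impI \<eta>)
    fix x assume x: "x \<in> G" and "dist x x0 < \<eta>"
    then have near: "norm (x - x0) < \<eta>"
      by (simp add: dist_norm)
    have le: "(D x - D x0) h \<le> e / 2 * norm h" for h
    proof (cases "h = 0")
      case False
      define k where "k = (\<eta> / norm h) *\<^sub>R h"
      have k: "norm k = \<eta>"
        using False \<eta> by (simp add: k_def)
      have n: "norm (x + k - x0) < 2 * \<eta>"
        using norm_triangle_ineq[of "x - x0" k] near k by (simp add: algebra_simps)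
      have "x + k \<in> ball x0 r"
        using n \<eta> by (simp add: dist_norm norm_minus_commute)
      then have xk: "x + k \<in> edom \<Psi>"
        using r G_subset by blast
      have "f x + D x k \<le> f (x + k)"
        using subgradient[OF x xk] by simp
      moreover have "f x0 + D x0 (x - x0) \<le> f x"
        by (rule subgradient[OF x0 G_subset[OF x]])
      moreover have "f (x + k) - f x0 - D x0 (x + k - x0) \<le> e / 8 * norm (x + k - x0)"
        by (rule order_trans[OF abs_ge_self small]) (use n \<eta> in simp)
      moreover have "e / 8 * norm (x + k - x0) \<le> e / 4 * \<eta>"
        using mult_left_mono[of "norm (x + k - x0)" "2 * \<eta>" "e / 8"] n e by simp
      moreover have "e / 4 * \<eta> \<le> e / 2 * \<eta>"
        using e \<eta> by simp
      moreover have "D x0 (x + k - x0) = D x0 k + D x0 (x - x0)"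
        by (simp add: blinfun.bilinear_simps)
      ultimately have "D x k - D x0 k \<le> e / 2 * \<eta>"
        by linarith
      then have "(D x - D x0) k \<le> e / 2 * \<eta>"
        by (simp add: blinfun.diff_left)
      moreover have "(D x - D x0) k = \<eta> * ((D x - D x0) h / norm h)"
        by (simp add: k_def blinfun.bilinear_simps)
      ultimately have "\<eta> * ((D x - D x0) h / norm h) \<le> \<eta> * (e / 2)"
        by (simp add: mult.commute)
      then show ?thesis
        using \<eta>(1) False by (simp add: field_simps)
    qed simp
    have "norm (D x - D x0) \<le> e / 2"
    proof (rule norm_blinfun_bound)
      show "norm ((D x - D x0) h) \<le> e / 2 * norm h" for h
        using le[of h] le[of "- h"] by (simp add: blinfun.minus_right abs_le_iff)
    qed (use e in simp)
    then show "dist (D x) (D x0) < e"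
      using e by (simp add: dist_norm)
  qed
qed

section \<open>The Bregman distance and total convexity\<close>

definition B :: "'a \<Rightarrow> 'a \<Rightarrow> real" where "B x y = f x - f y - D y (x - y)"

lemma bregman_eq: "x \<in> edom \<Psi> \<Longrightarrow> y \<in> edom \<Psi> \<Longrightarrow> bregman \<Psi> x y = ereal (B x y)"
  by (simp add: bregman_def B_def Psi_eq)

lemma B_nonneg: "x \<in> edom \<Psi> \<Longrightarrow> y \<in> G \<Longrightarrow> 0 \<le> B x y"
  using subgradient[of y x] by (simp add: B_def)

lemma B_combination:
  assumes "x \<in> edom \<Psi>" "z \<in> edom \<Psi>" "0 \<le> u" "u \<le> 1"
  shows "B ((1 - u) *\<^sub>R x + u *\<^sub>R z) y \<le> (1 - u) * B x y + u * B z y"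
  using convex_onD[OF f_convex assms(3,4,1,2)]
  by (simp add: B_def blinfun.bilinear_simps algebra_simps)

lemma right_dir_derivative_eq:
  assumes "x \<in> G" "y \<in> edom \<Psi>"
  shows "right_dir_derivative \<Psi> x (y - x) = ereal (D x (y - x))"
  unfolding right_dir_derivative_def
proof (rule tendsto_Lim)
  have "((\<lambda>t. ereal ((f (x + t *\<^sub>R (y - x)) - f x) / t)) \<longlongrightarrow> ereal (D x (y - x))) (at_right 0)"
    by (intro tendsto_intros directional assms)
  moreover have "eventually (\<lambda>t. ereal ((f (x + t *\<^sub>R (y - x)) - f x) / t) =
      (\<Psi> (x + t *\<^sub>R (y - x)) - \<Psi> x) / ereal t) (at_right 0)"
    using eventually_at_right_real[of 0 1, simplified]
  proof eventually_elim
    case (elim t)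
    have "x + t *\<^sub>R (y - x) = (1 - t) *\<^sub>R x + t *\<^sub>R y"
      by (simp add: algebra_simps)
    also have "\<dots> \<in> edom \<Psi>"
      using elim by (intro combination_edom assms G_subset) auto
    finally show ?case
      using elim by (simp add: Psi_eq G_subset assms)
  qed
  ultimately show "((\<lambda>t. (\<Psi> (x + t *\<^sub>R (y - x)) - \<Psi> x) / ereal t) \<longlongrightarrow> ereal (D x (y - x))) (at_right 0)"
    by (rule Lim_transform_eventually)
qed simp

text \<open>The modulus controls only the sphere of radius \<open>\<delta>\<close>. Convexity of
  \<open>B\<close> in its first argument, with value 0 at \<open>p\<close>, extends the bound
  linearly along rays beyond the sphere.\<close>

lemma total_convexity_bound:
  assumes "totally_convex_on_dom \<Psi>" and p: "p \<in> G" and \<delta>: "0 < \<delta>"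
  obtains c where "0 < c" "\<And>x. x \<in> edom \<Psi> \<Longrightarrow> \<delta> \<le> norm (x - p) \<Longrightarrow> c * norm (x - p) \<le> B x p"
proof -
  have "0 < total_convexity_modulus \<Psi> p \<delta>"
    using assms G_subset by (auto simp: totally_convex_on_dom_def)
  then obtain c where c: "0 < ereal c" "ereal c < total_convexity_modulus \<Psi> p \<delta>"
    using ereal_dense2 by blast
  have sphere: "c \<le> B z p" if z: "z \<in> edom \<Psi>" "norm (z - p) = \<delta>" for z
  proof -
    have "total_convexity_modulus \<Psi> p \<delta> \<le> \<Psi> z - \<Psi> p - right_dir_derivative \<Psi> p (z - p)"
      unfolding total_convexity_modulus_def using z by (intro Inf_lower) blast
    also have "\<dots> = ereal (B z p)"
      using z p by (simp add: right_dir_derivative_eq Psi_eq G_subset B_def)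
    finally show ?thesis
      using c(2) by (metis ereal_less_eq(3) less_imp_le order_trans)
  qed
  show ?thesis
  proof (rule that)
    show "0 < c / \<delta>"
      using c(1) \<delta> by simp
    fix x assume x: "x \<in> edom \<Psi>" "\<delta> \<le> norm (x - p)"
    \<comment> \<open>This weight puts the point \<open>?z\<close> of the segment from
      \<open>p\<close> to \<open>x\<close> on the sphere.\<close>
    define u where "u = \<delta> / norm (x - p)"
    have u: "0 < u" "u \<le> 1" "u * norm (x - p) = \<delta>"
      using x(2) \<delta> order_less_le_trans[OF \<delta> x(2)] by (auto simp: u_def)
    let ?z = "(1 - u) *\<^sub>R p + u *\<^sub>R x"
    have "?z - p = u *\<^sub>R (x - p)"
      by (simp add: algebra_simps)
    then have "norm (?z - p) = \<delta>"
      using u by simp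
    moreover have "?z \<in> edom \<Psi>"
      using convexD_alt[OF convex_edom G_subset[OF p] x(1)] u by simp
    ultimately have "c \<le> B ?z p"
      by (intro sphere)
    also have "\<dots> \<le> (1 - u) * B p p + u * B x p"
      using u by (intro B_combination G_subset p x) auto
    also have "B p p = 0"
      by (simp add: B_def)
    finally have "c * norm (x - p) \<le> (u * norm (x - p)) * B x p"
      using mult_right_mono[of c "u * B x p" "norm (x - p)"] by (simp add: mult_ac)
    then show "c / \<delta> * norm (x - p) \<le> B x p"
      using \<delta> by (simp add: u(3) field_simps)
  qed
qed

lemma B_pos:
  assumes "totally_convex_on_dom \<Psi>" "p \<in> G" "x \<in> edom \<Psi>" "x \<noteq> p"
  shows "0 < B x p"
proof -
  obtain c where "0 < c" "c * norm (x - p) \<le> B x p"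
    using total_convexity_bound[OF assms(1,2), of "norm (x - p)"] assms(3,4)
    by (metis order_refl right_minus_eq zero_less_norm_iff)
  moreover have "0 < c * norm (x - p)"
    using \<open>0 < c\<close> assms(4) by simp
  ultimately show ?thesis
    by simp
qed

lemma B_sublevel_bounded:
  assumes "supercoercive \<Psi>" and y: "y \<in> G"
  shows "bounded {x \<in> edom \<Psi>. B x y \<le> c}"
proof -
  \<comment> \<open>A slope one above \<open>norm (D y)\<close>: on the sublevel set the linear term
    is absorbed, leaving \<open>norm x\<close> below the constant \<open>M\<close>.\<close>
  define L where "L = norm (D y) + 1"
  have "eventually (\<lambda>x. ereal L < \<Psi> x / ereal (norm x)) at_infinity"
    using assms(1) by (simp add: supercoercive_def tendsto_PInfty)
  then obtain R where R: "\<And>x. R \<le> norm x \<Longrightarrow> ereal L < \<Psi> x / ereal (norm x)"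
    by (auto simp: eventually_at_infinity)
  define M where "M = c + f y - D y y"
  have "norm x \<le> max (max R 1) M" if x: "x \<in> edom \<Psi>" "B x y \<le> c" for x
  proof (rule ccontr)
    assume "\<not> norm x \<le> max (max R 1) M"
    then have big: "R \<le> norm x" "1 \<le> norm x" "M < norm x"
      by auto
    have "L < f x / norm x"
      using R[OF big(1)] big(2) x by (simp add: Psi_eq split: if_splits)
    then have "L * norm x < f x"
      using big(2) by (subst (asm) pos_less_divide_eq) linarith+
    also have "f x \<le> M + D y x"
      using x by (simp add: B_def M_def blinfun.diff_right)
    also have "D y x \<le> norm (D y) * norm x"
      using norm_blinfun[of "D y" x] by (simp add: abs_le_iff)
    finally show False
      using big by (simp add: L_def distrib_right)
  qed
  then show ?thesis
    by (auto simp: bounded_iff)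
qed

end

section \<open>The left projection\<close>

locale left_projection_setting = frechet_convex +
  fixes K :: "'a set"
  assumes refl: "reflexive TYPE('a)"
    and K: "K \<noteq> {}" "K \<subseteq> interior (edom \<Psi>)" "convex K" "closed K"
    and total: "totally_convex_on_dom \<Psi>" and super: "supercoercive \<Psi>"
begin

lemma K_edom: "x \<in> K \<Longrightarrow> x \<in> edom \<Psi>"
  using K(2) G_subset by blast

lemma minimiser_exists:
  assumes y: "y \<in> G"
  obtains p where "p \<in> K" "\<And>x. x \<in> K \<Longrightarrow> B p y \<le> B x y"
proof -
  define m where "m = (INF x\<in>K. B x y)"
  \<comment> \<open>With \<open>Suc n\<close> every slack is positive; at \<open>n = 0\<close>,
    \<open>1 / real n\<close> would be 0 and leave only minimisers, whose existence is at
    stake.\<close>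
  define C where "C n = {x \<in> K. B x y \<le> m + 1 / real (Suc n)}" for n
  have bdd: "bdd_below ((\<lambda>x. B x y) ` K)"
    using B_nonneg[OF K_edom y] by (intro bdd_belowI2)
  have "decseq C"
    by (rule decseq_SucI) (auto simp: C_def elim!: order_trans intro!: frac_le)
  moreover have "bounded (C 0)"
    by (rule bounded_subset[OF B_sublevel_bounded[OF super y]]) (auto simp: C_def K_edom)
  moreover have "closed (C n)" for n
    unfolding C_def B_def using K f_continuous
    by (intro continuous_on_closed_Collect_le continuous_intros continuous_at_imp_continuous_on) auto
  moreover have "convex (C n)" for n
    unfolding convex_alt
  proof (intro ballI allI impI)
    fix x z and u :: real
    assume xz: "x \<in> C n" "z \<in> C n" and u: "0 \<le> u \<and> u \<le> 1"
    have "B ((1 - u) *\<^sub>R x + u *\<^sub>R z) y \<le> (1 - u) * B x y + u * B z y"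
      using xz u by (intro B_combination) (auto simp: C_def K_edom)
    also have "\<dots> \<le> m + 1 / real (Suc n)"
      using xz u by (intro convex_bound_le) (auto simp: C_def)
    finally show "(1 - u) *\<^sub>R x + u *\<^sub>R z \<in> C n"
      using xz u convexD_alt[OF K(3)] by (auto simp: C_def)
  qed
  moreover have "C n \<noteq> {}" for n
  proof -
    have "m < m + 1 / real (Suc n)"
      by simp
    then obtain x where "x \<in> K" "B x y < m + 1 / real (Suc n)"
      unfolding m_def using cINF_less_iff[OF K(1) bdd] by blast
    then show ?thesis
      by (force simp: C_def)
  qed
  ultimately obtain p where p: "\<And>n. p \<in> C n"
    using reflexive_Inter_nonempty[OF refl] by metis
  have "B p y \<le> m"
  proof (rule field_le_epsilon)
    fix e :: real assume "0 < e"
    then obtain n where "1 / real (Suc n) < e"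
      using nat_approx_posE by blast
    then show "B p y \<le> m + e"
      using p[of n] by (simp add: C_def)
  qed
  show ?thesis
  proof
    show "p \<in> K"
      using p by (auto simp: C_def)
    show "B p y \<le> B x y" if "x \<in> K" for x
      using \<open>B p y \<le> m\<close> cINF_lower[OF bdd that] by (simp add: m_def)
  qed
qed

text \<open>First-order optimality of \<open>p\<close> along segments in \<open>K\<close> gives
  \<open>D y (x - p) \<le> D p (x - p)\<close>, and \<open>B x y - B p y - B x p\<close> is the
  difference of these two terms.\<close>

lemma three_point:
  assumes y: "y \<in> G" and p: "p \<in> K" "\<And>x. x \<in> K \<Longrightarrow> B p y \<le> B x y" and x: "x \<in> K"
  shows "B p y + B x p \<le> B x y"
proof -
  have "D y (x - p) \<le> D p (x - p)"
  proof (rule tendsto_lowerbound[OF directional])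
    show "p \<in> G" using p K by auto
    have "D y (x - p) \<le> (f (p + t *\<^sub>R (x - p)) - f p) / t" if t: "0 < t" "t < 1" for t
    proof -
      have eq: "p + t *\<^sub>R (x - p) = (1 - t) *\<^sub>R p + t *\<^sub>R x"
        by (simp add: algebra_simps)
      have "p + t *\<^sub>R (x - p) \<in> K"
        unfolding eq using convexD_alt[OF K(3) p(1) x, of t] t by simp
      then have "B p y \<le> B (p + t *\<^sub>R (x - p)) y"
        by (rule p(2))
      then have "t * D y (x - p) \<le> f (p + t *\<^sub>R (x - p)) - f p"
        by (simp add: B_def blinfun.bilinear_simps algebra_simps)
      then show ?thesis
        using t by (simp add: field_simps)
    qed
    then show "eventually (\<lambda>t. D y (x - p) \<le> (f (p + t *\<^sub>R (x - p)) - f p) / t) (at_right 0)"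
      using eventually_at_right_real[of 0 1] by (auto elim: eventually_mono)
  qed simp
  then show ?thesis
    by (simp add: B_def blinfun.bilinear_simps algebra_simps)
qed

lemma is_left_projection_iff:
  assumes "y \<in> G"
  shows "is_left_projection \<Psi> K y p \<longleftrightarrow> p \<in> K \<and> (\<forall>x\<in>K. B p y \<le> B x y)"
  using assms K_edom G_subset
  by (auto simp: is_left_projection_def is_arg_min_def bregman_eq not_less)

text \<open>For a second minimiser \<open>q\<close> the three-point inequality leaves
  \<open>B q p \<le> 0\<close>, which total convexity allows only for \<open>q = p\<close>.\<close>

lemma left_projection_unique:
  assumes y: "y \<in> G"
  shows "\<exists>!p. is_left_projection \<Psi> K y p"
proof -
  obtain p where p: "p \<in> K" "\<And>x. x \<in> K \<Longrightarrow> B p y \<le> B x y"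
    using minimiser_exists[OF y] by blast
  show ?thesis
  proof (rule ex1I[of _ p])
    show "is_left_projection \<Psi> K y p"
      using p y by (simp add: is_left_projection_iff)
    fix q assume "is_left_projection \<Psi> K y q"
    then have q: "q \<in> K" "B q y \<le> B p y"
      using p y by (auto simp: is_left_projection_iff)
    then have "B q p \<le> 0"
      using three_point[OF y p, of q] by simp
    then show "q = p"
      using B_pos[OF total _ K_edom, of p q] p q K by force
  qed
qed

abbreviation P :: "'a \<Rightarrow> 'a" where "P \<equiv> left_projection \<Psi> K"

lemma P:
  assumes "y \<in> G"
  shows P_mem: "P y \<in> K" and P_le: "\<And>x. x \<in> K \<Longrightarrow> B (P y) y \<le> B x y"
  using theI'[OF left_projection_unique[OF assms], folded left_projection_def]
  unfolding is_left_projection_iff[OF assms] by auto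

lemma P_continuous: "continuous_on G P"
  unfolding continuous_on_iff
proof (intro ballI allI impI)
  fix y and e :: real
  assume y: "y \<in> G" and e: "0 < e"
  \<comment> \<open>The slope is taken at the fixed point \<open>P y\<close>, so \<open>c\<close>
    does not depend on \<open>z\<close>.\<close>
  obtain c where c: "0 < c"
    "\<And>x. x \<in> edom \<Psi> \<Longrightarrow> e \<le> norm (x - P y) \<Longrightarrow> c * norm (x - P y) \<le> B x (P y)"
    using total_convexity_bound[OF total _ e, of "P y"] P_mem[OF y] K(2) by blast
  obtain d where d: "0 < d" "\<And>z. z \<in> G \<Longrightarrow> dist z y < d \<Longrightarrow> dist (D z) (D y) < c"
    using D_continuous y c(1) unfolding continuous_on_iff by blast
  show "\<exists>d>0. \<forall>z\<in>G. dist z y < d \<longrightarrow> dist (P z) (P y) < e"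
  proof (intro exI[of _ d] conjI ballI impI d(1), rule ccontr)
    fix z assume z: "z \<in> G" "dist z y < d"
    assume "\<not> dist (P z) (P y) < e"
    then have far: "e \<le> norm (P z - P y)"
      by (simp add: dist_norm)
    have "c * norm (P z - P y) \<le> B (P z) (P y)"
      by (rule c(2)[OF K_edom[OF P_mem[OF z(1)]] far])
    also have "\<dots> \<le> B (P z) y - B (P y) y"
      using three_point[OF y P_mem[OF y] P_le[OF y] P_mem[OF z(1)]] by simp
    \<comment> \<open>Minimality of \<open>P z\<close> for \<open>z\<close> bounds
      \<open>f (P z) - f (P y)\<close> by \<open>D z (P z - P y)\<close>.\<close>
    also have "\<dots> \<le> (D z - D y) (P z - P y)"
      using P_le[OF z(1) P_mem[OF y]] by (simp add: B_def blinfun.bilinear_simps)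
    also have "\<dots> \<le> norm (D z - D y) * norm (P z - P y)"
      using norm_blinfun[of "D z - D y" "P z - P y"] by (simp add: abs_le_iff)
    also have "\<dots> < c * norm (P z - P y)"
      using d(2)[OF z] far e by (intro mult_strict_right_mono) (auto simp: dist_norm)
    finally show False
      by simp
  qed
qed

theorem left_projection_continuous: "left_projection_continuous \<Psi> K"
  unfolding left_projection_continuous_def using left_projection_unique P_continuous by blast

text \<open>The infimum is attained at the projection, so it is a composition of \<open>f\<close>,
  \<open>D\<close> and \<open>P\<close>, all continuous on \<open>G\<close>.\<close>

theorem distance_continuous: "continuous_on G (\<lambda>x. INF y\<in>K. bregman \<Psi> y x)"
proof -
  have "(INF x\<in>K. bregman \<Psi> x y) = ereal (B (P y) y)" if y: "y \<in> G" for y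
  proof (rule antisym)
    show "(INF x\<in>K. bregman \<Psi> x y) \<le> ereal (B (P y) y)"
      using P_mem[OF y] y by (intro INF_lower2[of "P y"]) (auto simp: bregman_eq K_edom G_subset)
    show "ereal (B (P y) y) \<le> (INF x\<in>K. bregman \<Psi> x y)"
      using P_le[OF y] y by (intro INF_greatest) (auto simp: bregman_eq K_edom G_subset)
  qed
  moreover have "continuous_on G (\<lambda>y. ereal (B (P y) y))"
  proof -
    have f: "continuous_on G f"
      using f_continuous by (intro continuous_at_imp_continuous_on) auto
    have "continuous_on G (\<lambda>y. f (P y))"
      using P_mem K(2) by (intro continuous_on_compose2[OF f P_continuous]) auto
    then show ?thesis
      unfolding B_def by (intro continuous_intros f D_continuous P_continuous)
  qed
  ultimately show ?thesis
    by (simp cong: continuous_on_cong)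
qed

end

section \<open>Conjugates and the right projection\<close>

lemma convex_fun_conjugate:
  assumes "proper_fun \<Psi>"
  shows "convex_fun (conjugate \<Psi>)"
  unfolding convex_fun_def
proof (intro allI impI)
  fix \<phi> \<psi> :: "'a \<Rightarrow>\<^sub>L real" and u :: real
  assume u: "0 < u \<and> u < 1"
  show "conjugate \<Psi> ((1 - u) *\<^sub>R \<phi> + u *\<^sub>R \<psi>) \<le> ereal (1 - u) * conjugate \<Psi> \<phi> + ereal u * conjugate \<Psi> \<psi>"
    unfolding conjugate_def[of \<Psi> "(1 - u) *\<^sub>R \<phi> + u *\<^sub>R \<psi>"]
  proof (rule SUP_least)
    fix x
    show "ereal (((1 - u) *\<^sub>R \<phi> + u *\<^sub>R \<psi>) x) - \<Psi> x \<le> ereal (1 - u) * conjugate \<Psi> \<phi> + ereal u * conjugate \<Psi> \<psi>"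
    proof (cases "\<Psi> x")
      case (real r)
      have le: "ereal (\<zeta> x - r) \<le> conjugate \<Psi> \<zeta>" for \<zeta> :: "'a \<Rightarrow>\<^sub>L real"
        unfolding conjugate_def by (rule SUP_upper2[of x]) (simp_all add: real)
      have "ereal (((1 - u) *\<^sub>R \<phi> + u *\<^sub>R \<psi>) x) - \<Psi> x = ereal (1 - u) * ereal (\<phi> x - r) + ereal u * ereal (\<psi> x - r)"
        by (simp add: real blinfun.bilinear_simps algebra_simps)
      also have "\<dots> \<le> ereal (1 - u) * conjugate \<Psi> \<phi> + ereal u * conjugate \<Psi> \<psi>"
        using u by (intro add_mono ereal_mult_left_mono le) auto
      finally show ?thesis .
    qed (use assms in \<open>auto simp: proper_fun_def\<close>)
  qed
qed

lemma proper_fun_conjugate: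
  assumes "proper_fun \<Psi>" "edom (conjugate \<Psi>) \<noteq> {}"
  shows "proper_fun (conjugate \<Psi>)"
proof -
  obtain x where x: "\<Psi> x \<noteq> \<infinity>" "\<Psi> x \<noteq> -\<infinity>"
    using assms(1) by (auto simp: proper_fun_def edom_def)
  have "ereal (blinfun_apply \<phi> x) - \<Psi> x \<le> conjugate \<Psi> \<phi>" for \<phi>
    unfolding conjugate_def by (rule SUP_upper) simp
  then have "conjugate \<Psi> \<phi> \<noteq> -\<infinity>" for \<phi>
    using x by (cases "\<Psi> x") (auto, metis MInfty_neq_ereal(1) ereal_infty_less_eq(2))
  then show ?thesis
    using assms(2) by (simp add: proper_fun_def)
qed

context frechet_convex
begin

lemma conjugate_ge: "x \<in> edom \<Psi> \<Longrightarrow> ereal (blinfun_apply \<phi> x - f x) \<le> conjugate \<Psi> \<phi>"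
  unfolding conjugate_def by (rule SUP_upper2[of x]) (simp_all add: Psi_eq)

text \<open>The subgradient inequality at \<open>x\<close> says that \<open>x\<close> itself attains
  the supremum defining the conjugate.\<close>

lemma conjugate_D:
  assumes x: "x \<in> G"
  shows "conjugate \<Psi> (D x) = ereal (D x x - f x)"
proof (rule antisym)
  show "conjugate \<Psi> (D x) \<le> ereal (D x x - f x)"
    unfolding conjugate_def
  proof (rule SUP_least)
    show "ereal (D x z) - \<Psi> z \<le> ereal (D x x - f x)" for z
    proof (cases "z \<in> edom \<Psi>")
      case True
      then show ?thesis
        using subgradient[OF x True] by (simp add: Psi_eq blinfun.diff_right)
    qed (simp add: Psi_eq_infinity)
  qed
qed (rule conjugate_ge[OF G_subset[OF x]])

end

section \<open>Duality between \<Psi> and its conjugate\<close>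

text \<open>Kept apart from the projection setting because case (iv) must first prove here that
  \<open>D\<close> maps into the interior of the dual domain.\<close>

locale frechet_convex_pair = frechet_convex +
  assumes G_nonempty: "interior (edom \<Psi>) \<noteq> {}"
    and frechet_conjugate: "frechet_differentiable_on_int_dom (conjugate \<Psi>)"
begin

lemma D_edom: "x \<in> G \<Longrightarrow> D x \<in> edom (conjugate \<Psi>)"
  by (simp add: edom_def conjugate_D)

sublocale dual: frechet_convex "conjugate \<Psi>"
  using proper proper_fun_conjugate convex_fun_conjugate frechet_conjugate D_edom G_nonempty
  by unfold_locales blast+

lemma dual_f_D: "x \<in> G \<Longrightarrow> dual.f (D x) = D x x - f x"
  by (simp add: dual.f_def conjugate_D)

text \<open>Young's inequality at \<open>\<eta>\<close>, combined with its equality case at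
  \<open>D x\<close>.\<close>

lemma dual_subgradient:
  assumes "x \<in> G" "\<eta> \<in> edom (conjugate \<Psi>)"
  shows "dual.f (D x) + bidual_embedding x (\<eta> - D x) \<le> dual.f \<eta>"
  using conjugate_ge[OF G_subset[OF assms(1)], of \<eta>] assms
  by (simp add: dual.Psi_eq dual_f_D blinfun.bilinear_simps)

text \<open>At a boundary point of the domain of \<open>\<Psi>\<^sup>*\<close>, a supporting functional could be added to any
  subgradient, so the subdifferential there is empty or not a singleton.\<close>

lemma D_mem_interior:
  assumes egd: "essentially_gateaux_differentiable (conjugate \<Psi>)" and x: "x \<in> G"
  shows "D x \<in> dual.G"
proof (rule ccontr)
  assume "D x \<notin> dual.G"
  moreover have "dual.G \<noteq> {}"
    using egd by (simp add: essentially_gateaux_differentiable_def)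
  ultimately obtain v :: "('a \<Rightarrow>\<^sub>L real) \<Rightarrow>\<^sub>L real"
    where v: "v \<noteq> 0" "\<And>\<eta>. \<eta> \<in> edom (conjugate \<Psi>) \<Longrightarrow> v (D x) \<le> v \<eta>"
    using supporting_functional[OF dual.convex_edom] by metis
  have sub: "g \<in> subdifferential (conjugate \<Psi>) (D x)"
    if "\<And>\<eta>. \<eta> \<in> edom (conjugate \<Psi>) \<Longrightarrow> dual.f (D x) + blinfun_apply g (\<eta> - D x) \<le> dual.f \<eta>" for g
    unfolding subdifferential_def
  proof (intro CollectI conjI allI D_edom[OF x])
    show "conjugate \<Psi> (D x) + ereal (g (\<eta> - D x)) \<le> conjugate \<Psi> \<eta>" for \<eta>
      using that[of \<eta>] D_edom[OF x] dual.Psi_eq_infinity[of \<eta>]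
      by (cases "\<eta> \<in> edom (conjugate \<Psi>)") (simp_all add: dual.Psi_eq)
  qed
  have "bidual_embedding x \<in> subdifferential (conjugate \<Psi>) (D x)"
    by (rule sub) (rule dual_subgradient[OF x])
  \<comment> \<open>On the domain \<open>v (\<eta> - D x)\<close> is nonnegative, so subtracting
    \<open>v\<close> only lowers the affine minorant.\<close>
  moreover have "bidual_embedding x - v \<in> subdifferential (conjugate \<Psi>) (D x)"
  proof (rule sub)
    show "dual.f (D x) + (bidual_embedding x - v) (\<eta> - D x) \<le> dual.f \<eta>"
      if "\<eta> \<in> edom (conjugate \<Psi>)" for \<eta>
      using dual_subgradient[OF x that] v(2)[OF that] by (simp add: blinfun.bilinear_simps)
  qed
  moreover obtain g where "subdifferential (conjugate \<Psi>) (D x) = {g}"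
    using egd calculation(1) unfolding essentially_gateaux_differentiable_def is_singleton_def
    by (metis empty_iff)
  ultimately have "bidual_embedding x = bidual_embedding x - v"
    by simp
  then show False
    using v(1) by simp
qed

end

locale right_projection_setting = frechet_convex_pair +
  fixes K :: "'a set"
  assumes refl: "reflexive TYPE('a)"
    and K: "K \<noteq> {}" "K \<subseteq> interior (edom \<Psi>)"
    and DK: "convex (gateaux_derivative \<Psi> ` K)" "closed (gateaux_derivative \<Psi> ` K)"
    and D_G: "gateaux_derivative \<Psi> ` interior (edom \<Psi>) \<subseteq> interior (edom (conjugate \<Psi>))"
    and total: "totally_convex_on_dom (conjugate \<Psi>)" and super: "supercoercive (conjugate \<Psi>)"
begin

sublocale dual: left_projection_setting "conjugate \<Psi>" "D ` K"
  using reflexive_dual[OF refl] K DK D_G total super by unfold_locales auto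

lemma D_mem: "x \<in> G \<Longrightarrow> D x \<in> dual.G"
  using D_G by blast

text \<open>The embedded point is a subgradient of the conjugate at \<open>D x\<close>, which is
  interior, hence it is the derivative there.\<close>

lemma dual_D: "x \<in> G \<Longrightarrow> dual.D (D x) = bidual_embedding x"
  using dual.subgradient_unique[OF D_mem dual_subgradient] by metis

lemma D_inj: "x \<in> G \<Longrightarrow> y \<in> G \<Longrightarrow> D x = D y \<Longrightarrow> x = y"
  using dual_D[of x] dual_D[of y] dist_bidual_embedding[of x y] by simp

text \<open>Passing to the conjugate swaps the arguments, which turns right projections into left
  ones.\<close>

lemma dual_B: "x \<in> G \<Longrightarrow> y \<in> G \<Longrightarrow> dual.B (D x) (D y) = B y x"
  by (simp add: dual.B_def B_def dual_f_D dual_D blinfun.bilinear_simps)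

text \<open>The condition \<open>p \<in> K\<close> stands separately: \<open>D\<close> is
  uncontrolled outside \<open>G\<close>, so membership of \<open>D p\<close> in the image of
  \<open>K\<close> does not place \<open>p\<close> in \<open>K\<close>.\<close>

lemma is_right_projection_iff:
  assumes y: "y \<in> G"
  shows "is_right_projection \<Psi> K y p \<longleftrightarrow>
    p \<in> K \<and> is_left_projection (conjugate \<Psi>) (D ` K) (D y) (D p)"
proof -
  have b: "bregman \<Psi> y x = ereal (B y x)" if "x \<in> K" for x
    using that y K(2) G_subset by (intro bregman_eq) auto
  have d: "dual.B (D x) (D y) = B y x" if "x \<in> K" for x
    using that y K(2) by (intro dual_B) auto
  have "is_right_projection \<Psi> K y p \<longleftrightarrow> p \<in> K \<and> (\<forall>x\<in>K. B y p \<le> B y x)"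
    unfolding is_right_projection_def is_arg_min_def
    by (auto simp: b not_less)
  also have "\<dots> \<longleftrightarrow> p \<in> K \<and> (\<forall>x\<in>K. dual.B (D p) (D y) \<le> dual.B (D x) (D y))"
    by (auto simp: d)
  finally show ?thesis
    unfolding dual.is_left_projection_iff[OF D_mem[OF y]] by blast
qed

lemma is_left_projection_eq:
  assumes "y \<in> G"
  shows "is_left_projection (conjugate \<Psi>) (D ` K) (D y) q \<longleftrightarrow> q = dual.P (D y)"
  using dual.left_projection_unique[OF D_mem[OF assms]]
    theI'[OF dual.left_projection_unique[OF D_mem[OF assms]], folded left_projection_def]
  by blast

lemma right_projection_unique:
  assumes y: "y \<in> G"
  shows "\<exists>!p. is_right_projection \<Psi> K y p"
proof -
  obtain p where p: "p \<in> K" "dual.P (D y) = D p"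
    using dual.P_mem[OF D_mem[OF y]] by blast
  show ?thesis
  proof (rule ex1I[of _ p])
    show "is_right_projection \<Psi> K y p"
      using p by (simp add: is_right_projection_iff[OF y] is_left_projection_eq[OF y])
    fix q assume "is_right_projection \<Psi> K y q"
    then have "q \<in> K" "D q = D p"
      using p by (simp_all add: is_right_projection_iff[OF y] is_left_projection_eq[OF y])
    then show "q = p"
      using D_inj p(1) K(2) by blast
  qed
qed

text \<open>Up to the isometric embedding, the right projection is \<open>D\<close> followed by the
  dual left projection and then by the derivative of the conjugate, all continuous.\<close>

theorem right_projection_continuous: "right_projection_continuous \<Psi> K"
proof -
  have eq: "bidual_embedding (right_projection \<Psi> K y) = dual.D (dual.P (D y))" if y: "y \<in> G" for y
  proof -
    have "is_right_projection \<Psi> K y (right_projection \<Psi> K y)"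
      unfolding right_projection_def by (rule theI'[OF right_projection_unique[OF y]])
    then have "right_projection \<Psi> K y \<in> K" "dual.P (D y) = D (right_projection \<Psi> K y)"
      by (simp_all add: is_right_projection_iff[OF y] is_left_projection_eq[OF y])
    then show ?thesis
      using K(2) dual_D by (metis subsetD)
  qed
  have P: "continuous_on G (\<lambda>y. dual.P (D y))"
    by (rule continuous_on_compose2[OF dual.P_continuous D_continuous]) (use D_mem in blast)
  have "continuous_on G (\<lambda>y. dual.D (dual.P (D y)))"
    by (rule continuous_on_compose2[OF dual.D_continuous P]) (use dual.P_mem[OF D_mem] dual.K in blast)
  then have "continuous_on G (right_projection \<Psi> K)"
    by (simp add: continuous_on_iff eq[symmetric] dist_bidual_embedding)
  then show ?thesis
    using right_projection_unique by (simp add: right_projection_continuous_def)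
qed

end

section \<open>Reduction of the four claims to the two projection settings\<close>

text \<open>Singletons are bounded sets; this reduces (ii) to (i), and (iv) to (iii) once the range
  of the derivative is known.\<close>

lemma totally_convex_on_bounded_imp_on_dom:
  assumes "totally_convex_on_bounded \<Psi>"
  shows "totally_convex_on_dom \<Psi>"
  unfolding totally_convex_on_dom_def
proof (intro allI impI ballI)
  fix t :: real and x
  assume t: "0 < t" and "x \<in> edom \<Psi>"
  then have "{x} \<inter> edom \<Psi> = {x}"
    by auto
  moreover have "0 < (INF x\<in>{x} \<inter> edom \<Psi>. total_convexity_modulus \<Psi> x t)"
    using assms t unfolding totally_convex_on_bounded_def by blast
  ultimately show "0 < total_convexity_modulus \<Psi> x t"
    by simp
qed

theorem proposition3p5:
  fixes \<Psi> :: "'a::banach \<Rightarrow> ereal" and K :: "'a set"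
  assumes "reflexive TYPE('a)"
    and "\<Psi> \<in> Gamma_G"
    and "frechet_differentiable_on_int_dom \<Psi>"
    and "K \<noteq> {}"
    and "K \<subseteq> interior (edom \<Psi>)"
  shows
    "(convex K \<and> closed K \<and> totally_convex_on_dom \<Psi> \<and> supercoercive \<Psi> \<longrightarrow>
        left_projection_continuous \<Psi> K \<and>
        continuous_on (interior (edom \<Psi>)) (\<lambda>x. INF y\<in>K. bregman \<Psi> y x)) \<and>
     (convex K \<and> closed K \<and> totally_convex_on_bounded \<Psi> \<and> supercoercive \<Psi> \<and>
        euler_legendre \<Psi> \<longrightarrow>
        left_projection_continuous \<Psi> K) \<and>
     (convex (gateaux_derivative \<Psi> ` K) \<and> closed (gateaux_derivative \<Psi> ` K) \<and>
        gateaux_derivative \<Psi> ` interior (edom \<Psi>) \<noteq> {} \<and>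
        gateaux_derivative \<Psi> ` interior (edom \<Psi>) \<subseteq> interior (edom (conjugate \<Psi>)) \<and>
        totally_convex_on_dom (conjugate \<Psi>) \<and>
        frechet_differentiable_on_int_dom (conjugate \<Psi>) \<and>
        supercoercive (conjugate \<Psi>) \<longrightarrow>
        right_projection_continuous \<Psi> K) \<and>
     (convex (gateaux_derivative \<Psi> ` K) \<and> closed (gateaux_derivative \<Psi> ` K) \<and>
        totally_convex_on_bounded (conjugate \<Psi>) \<and> euler_legendre (conjugate \<Psi>) \<and>
        frechet_differentiable_on_int_dom (conjugate \<Psi>) \<and>
        supercoercive (conjugate \<Psi>) \<longrightarrow>
        right_projection_continuous \<Psi> K)"
proof -
  interpret frechet_convex \<Psi>
    using assms(2,3) by unfold_locales (auto simp: Gamma_G_def)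
  have left: "left_projection_continuous \<Psi> K \<and>
      continuous_on (interior (edom \<Psi>)) (\<lambda>x. INF y\<in>K. bregman \<Psi> y x)"
    if "convex K" "closed K" "totally_convex_on_dom \<Psi>" "supercoercive \<Psi>"
  proof -
    interpret left_projection_setting \<Psi> K
      using assms that by unfold_locales auto
    show ?thesis
      using left_projection_continuous distance_continuous by blast
  qed
  have right: "right_projection_continuous \<Psi> K"
    if "convex (D ` K)" "closed (D ` K)" "D ` G \<subseteq> interior (edom (conjugate \<Psi>))"
      "totally_convex_on_dom (conjugate \<Psi>)" "frechet_differentiable_on_int_dom (conjugate \<Psi>)"
      "supercoercive (conjugate \<Psi>)"
  proof -
    interpret right_projection_setting \<Psi> K
      using assms that by unfold_locales auto
    show ?thesis
      by (rule right_projection_continuous)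
  qed
  \<comment> \<open>This supplies for (iv) the inclusion that (iii) has as a hypothesis.\<close>
  have interior: "D ` G \<subseteq> interior (edom (conjugate \<Psi>))"
    if "frechet_differentiable_on_int_dom (conjugate \<Psi>)" "euler_legendre (conjugate \<Psi>)"
  proof -
    interpret frechet_convex_pair \<Psi>
      using assms that by unfold_locales auto
    show ?thesis
      using D_mem_interior that(2) by (auto simp: euler_legendre_def)
  qed
  show ?thesis
    using left right interior totally_convex_on_bounded_imp_on_dom[of \<Psi>]
      totally_convex_on_bounded_imp_on_dom[of "conjugate \<Psi>"]
    by blast
qed

end
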